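(* Let $(M^6,J,g)$ be a strict nearly pseudo-Kähler manifold of real dimension six and of constant type $\alpha$. Then $(M,g)$ is a pseudo-Riemannian Einstein manifold with Einstein constant $5\alpha$, i.e. $\mathrm{Ric}=5\alpha\, g$.
   Context: Metrics are pseudo-Riemannian; $\nabla$ is the Levi-Civita connection of $g$. An almost pseudo-Hermitian manifold $(M,J,g)$ ($J^2=-\mathrm{Id}$, $g(J\cdot,J\cdot)=g$) is *nearly pseudo-Kähler* if $(\nabla_XJ)X=0$ for all vector fields $X$; *strict* if moreover $\nabla_XJ\neq0$ for all nonzero $X\in TM$. *Constant type $\alpha\in\mathbb R$* means $$g((\nabla_XJ)Y,(\nabla_XJ)Y)=\alpha\left(g(X,X)g(Y,Y)-g(X,Y)^2-g(JX,Y)^2\right)\quad\text{for all }X,Y.$$ (A strict nearly pseudo-Kähler six-manifold is known to be of constant type for some $\alpha\ne0$.) *)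

theory Defs
  imports "HOL-Analysis.Analysis"
begin

section \<open>Smooth maps between Euclidean spaces\<close>

text \<open>Only used on open sets \<open>S\<close> and finite-dimensional domains, where the iterated directional
  derivatives being continuous is the usual notion of \<open>C^k\<close>.\<close>

primrec Ck_on :: "nat \<Rightarrow> 'a set \<Rightarrow> ('a::real_normed_vector \<Rightarrow> 'b::real_normed_vector) \<Rightarrow> bool" where
  "Ck_on 0 S f \<longleftrightarrow> continuous_on S f"
| "Ck_on (Suc k) S f \<longleftrightarrow>
     (\<forall>x\<in>S. f differentiable (at x)) \<and> (\<forall>v. Ck_on k S (\<lambda>x. frechet_derivative f (at x) v))"

definition smooth_on :: "'a set \<Rightarrow> ('a::real_normed_vector \<Rightarrow> 'b::real_normed_vector) \<Rightarrow> bool" where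
  "smooth_on S f \<longleftrightarrow> (\<forall>k. Ck_on k S f)"


section \<open>Manifolds and tangent spaces\<close>

text \<open>A chart is a pair of its domain and its coordinate map.\<close>

type_synonym ('a, 'n) chart = "'a set \<times> ('a \<Rightarrow> real ^ 'n)"

definition chart_on :: "'a topology \<Rightarrow> ('a, 'n::finite) chart \<Rightarrow> bool" where
  "chart_on M c \<longleftrightarrow> openin M (fst c) \<and> open (snd c ` fst c) \<and>
     homeomorphic_map (subtopology M (fst c)) (top_of_set (snd c ` fst c)) (snd c)"

definition chart_inv :: "('a, 'n::finite) chart \<Rightarrow> real ^ 'n \<Rightarrow> 'a" where
  "chart_inv c = inv_into (fst c) (snd c)"

definition transition :: "('a, 'n::finite) chart \<Rightarrow> ('a, 'n) chart \<Rightarrow> real ^ 'n \<Rightarrow> real ^ 'n" where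
  "transition c c' = snd c' \<circ> chart_inv c"

definition smooth_manifold :: "'a topology \<Rightarrow> ('a, 'n::finite) chart set \<Rightarrow> bool" where
  "smooth_manifold M A \<longleftrightarrow>
     Hausdorff_space M \<and> second_countable M \<and>
     (\<forall>c\<in>A. chart_on M c) \<and> (\<Union>c\<in>A. fst c) = topspace M \<and>
     (\<forall>c\<in>A. \<forall>c'\<in>A. smooth_on (snd c ` (fst c \<inter> fst c')) (transition c c'))"

text \<open>A tangent vector at \<open>p\<close> is the family of its coordinate vectors in all charts around \<open>p\<close>;
  these are related by the derivatives of the transition maps. At charts not around \<open>p\<close> the family
  is set to 0, so that a tangent vector is determined by its coordinates.\<close>

type_synonym ('a, 'n) tvector = "('a, 'n) chart \<Rightarrow> real ^ 'n"

definition tangent_space :: "('a, 'n::finite) chart set \<Rightarrow> 'a \<Rightarrow> ('a, 'n) tvector set" where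
  "tangent_space A p = {v.
     (\<forall>c. \<not> (c \<in> A \<and> p \<in> fst c) \<longrightarrow> v c = 0) \<and>
     (\<forall>c\<in>A. \<forall>c'\<in>A. p \<in> fst c \<inter> fst c' \<longrightarrow>
        v c' = frechet_derivative (transition c c') (at (snd c p)) (v c))}"

text \<open>The tangent vector at \<open>p\<close> with coordinate vector \<open>u\<close> in the chart \<open>c\<close>.\<close>

definition tangent_of :: "('a, 'n::finite) chart set \<Rightarrow> ('a, 'n) chart \<Rightarrow> 'a \<Rightarrow> real ^ 'n \<Rightarrow> ('a, 'n) tvector" where
  "tangent_of A c p u = (\<lambda>c'. if c' \<in> A \<and> p \<in> fst c'
     then frechet_derivative (transition c c') (at (snd c p)) u else 0)"

definition tlincomb :: "real \<Rightarrow> ('a, 'n::finite) tvector \<Rightarrow> real \<Rightarrow> ('a, 'n) tvector \<Rightarrow> ('a, 'n) tvector" where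
  "tlincomb a v b w = (\<lambda>c. a *\<^sub>R v c + b *\<^sub>R w c)"


section \<open>Pseudo-Riemannian metrics and almost complex structures\<close>

type_synonym ('a, 'n) tmetric = "'a \<Rightarrow> ('a, 'n) tvector \<Rightarrow> ('a, 'n) tvector \<Rightarrow> real"
type_synonym ('a, 'n) tendo = "'a \<Rightarrow> ('a, 'n) tvector \<Rightarrow> ('a, 'n) tvector"

text \<open>Coordinate expressions in a chart, as fields on \<open>snd c ` fst c\<close>.\<close>

definition local_metric :: "('a, 'n::finite) chart set \<Rightarrow> ('a, 'n) tmetric \<Rightarrow> ('a, 'n) chart
    \<Rightarrow> real ^ 'n \<Rightarrow> real ^ 'n \<Rightarrow> real ^ 'n \<Rightarrow> real" where
  "local_metric A g c x u v =
     (let p = chart_inv c x in g p (tangent_of A c p u) (tangent_of A c p v))"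

definition local_endo :: "('a, 'n::finite) chart set \<Rightarrow> ('a, 'n) tendo \<Rightarrow> ('a, 'n) chart
    \<Rightarrow> real ^ 'n \<Rightarrow> real ^ 'n \<Rightarrow> real ^ 'n" where
  "local_endo A J c x u = (let p = chart_inv c x in J p (tangent_of A c p u) c)"

definition pseudo_riemannian_metric ::
    "'a topology \<Rightarrow> ('a, 'n::finite) chart set \<Rightarrow> ('a, 'n) tmetric \<Rightarrow> bool" where
  "pseudo_riemannian_metric M A g \<longleftrightarrow>
     (\<forall>p\<in>topspace M.
        (\<forall>u\<in>tangent_space A p. \<forall>v\<in>tangent_space A p. \<forall>w\<in>tangent_space A p. \<forall>a b.
            g p (tlincomb a u b v) w = a * g p u w + b * g p v w) \<and>
        (\<forall>u\<in>tangent_space A p. \<forall>v\<in>tangent_space A p. g p u v = g p v u) \<and>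
        (\<forall>u\<in>tangent_space A p. (\<forall>v\<in>tangent_space A p. g p u v = 0) \<longrightarrow> u = (\<lambda>_. 0))) \<and>
     (\<forall>c\<in>A. \<forall>u v. smooth_on (snd c ` fst c) (\<lambda>x. local_metric A g c x u v))"

definition almost_complex_structure ::
    "'a topology \<Rightarrow> ('a, 'n::finite) chart set \<Rightarrow> ('a, 'n) tendo \<Rightarrow> bool" where
  "almost_complex_structure M A J \<longleftrightarrow>
     (\<forall>p\<in>topspace M.
        (\<forall>u\<in>tangent_space A p. J p u \<in> tangent_space A p \<and> J p (J p u) = (\<lambda>c. - u c)) \<and>
        (\<forall>u\<in>tangent_space A p. \<forall>v\<in>tangent_space A p. \<forall>a b.
            J p (tlincomb a u b v) = tlincomb a (J p u) b (J p v))) \<and>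
     (\<forall>c\<in>A. \<forall>u. smooth_on (snd c ` fst c) (\<lambda>x. local_endo A J c x u))"

definition almost_pseudo_hermitian ::
    "'a topology \<Rightarrow> ('a, 'n::finite) chart set \<Rightarrow> ('a, 'n) tmetric \<Rightarrow> ('a, 'n) tendo \<Rightarrow> bool" where
  "almost_pseudo_hermitian M A g J \<longleftrightarrow>
     pseudo_riemannian_metric M A g \<and> almost_complex_structure M A J \<and>
     (\<forall>p\<in>topspace M. \<forall>u\<in>tangent_space A p. \<forall>v\<in>tangent_space A p. g p (J p u) (J p v) = g p u v)"


section \<open>The Levi-Civita connection in coordinates\<close>

text \<open>Here \<open>G\<close> is a metric in coordinates, and vector fields on an open subset of \<open>real ^ 'n\<close>
  are functions \<open>real ^ 'n \<Rightarrow> real ^ 'n\<close>.\<close>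

definition gram :: "(real ^ 'n \<Rightarrow> real ^ 'n \<Rightarrow> real ^ 'n \<Rightarrow> real) \<Rightarrow> real ^ 'n \<Rightarrow> real ^ 'n ^ 'n::finite" where
  "gram G x = (\<chi> i j. G x (axis i 1) (axis j 1))"

definition partial_deriv :: "'n::finite \<Rightarrow> (real ^ 'n \<Rightarrow> real) \<Rightarrow> real ^ 'n \<Rightarrow> real" where
  "partial_deriv i f x = frechet_derivative f (at x) (axis i 1)"

text \<open>\<open>christoffel G k i j\<close> is the symbol with upper index \<open>k\<close> and lower indices \<open>i\<close>, \<open>j\<close>.\<close>

definition christoffel :: "(real ^ 'n \<Rightarrow> real ^ 'n \<Rightarrow> real ^ 'n \<Rightarrow> real)
    \<Rightarrow> 'n::finite \<Rightarrow> 'n \<Rightarrow> 'n \<Rightarrow> real ^ 'n \<Rightarrow> real" where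
  "christoffel G k i j x = (1/2) * (\<Sum>l\<in>UNIV. matrix_inv (gram G x) $ k $ l *
     (partial_deriv i (\<lambda>y. gram G y $ j $ l) x + partial_deriv j (\<lambda>y. gram G y $ i $ l) x
      - partial_deriv l (\<lambda>y. gram G y $ i $ j) x))"

definition cov_deriv :: "(real ^ 'n \<Rightarrow> real ^ 'n \<Rightarrow> real ^ 'n \<Rightarrow> real)
    \<Rightarrow> (real ^ 'n \<Rightarrow> real ^ 'n) \<Rightarrow> (real ^ 'n \<Rightarrow> real ^ 'n) \<Rightarrow> real ^ 'n \<Rightarrow> real ^ 'n::finite" where
  "cov_deriv G X Y x = frechet_derivative Y (at x) (X x)
     + (\<chi> k. \<Sum>i\<in>UNIV. \<Sum>j\<in>UNIV. christoffel G k i j x * X x $ i * Y x $ j)"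

definition lie_bracket :: "(real ^ 'n \<Rightarrow> real ^ 'n) \<Rightarrow> (real ^ 'n \<Rightarrow> real ^ 'n) \<Rightarrow> real ^ 'n \<Rightarrow> real ^ 'n::finite" where
  "lie_bracket X Y x = frechet_derivative Y (at x) (X x) - frechet_derivative X (at x) (Y x)"

text \<open>\<open>(\<nabla>\<^sub>X J) Y\<close> for a field of endomorphisms \<open>J\<close>.\<close>

definition cov_deriv_endo :: "(real ^ 'n \<Rightarrow> real ^ 'n \<Rightarrow> real ^ 'n \<Rightarrow> real)
    \<Rightarrow> (real ^ 'n \<Rightarrow> real ^ 'n \<Rightarrow> real ^ 'n)
    \<Rightarrow> (real ^ 'n \<Rightarrow> real ^ 'n) \<Rightarrow> (real ^ 'n \<Rightarrow> real ^ 'n) \<Rightarrow> real ^ 'n \<Rightarrow> real ^ 'n::finite" where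
  "cov_deriv_endo G J X Y x = cov_deriv G X (\<lambda>y. J y (Y y)) x - J x (cov_deriv G X Y x)"

definition riemann :: "(real ^ 'n \<Rightarrow> real ^ 'n \<Rightarrow> real ^ 'n \<Rightarrow> real)
    \<Rightarrow> (real ^ 'n \<Rightarrow> real ^ 'n) \<Rightarrow> (real ^ 'n \<Rightarrow> real ^ 'n) \<Rightarrow> (real ^ 'n \<Rightarrow> real ^ 'n)
    \<Rightarrow> real ^ 'n \<Rightarrow> real ^ 'n::finite" where
  "riemann G X Y Z x = cov_deriv G X (cov_deriv G Y Z) x - cov_deriv G Y (cov_deriv G X Z) x
     - cov_deriv G (lie_bracket X Y) Z x"

text \<open>\<open>Ric v w = tr (u \<mapsto> R(u,v)w)\<close>; as \<open>R\<close> is a tensor, it may be evaluated on the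
  extensions of \<open>u\<close>, \<open>v\<close>, \<open>w\<close> that are constant in coordinates.\<close>

definition ricci :: "(real ^ 'n \<Rightarrow> real ^ 'n \<Rightarrow> real ^ 'n \<Rightarrow> real)
    \<Rightarrow> real ^ 'n \<Rightarrow> real ^ 'n \<Rightarrow> real ^ 'n::finite \<Rightarrow> real" where
  "ricci G x v w = trace (matrix (\<lambda>u. riemann G (\<lambda>_. u) (\<lambda>_. v) (\<lambda>_. w) x))"

text \<open>The connection above is the Levi-Civita connection: it is torsion-free and metric.
  Moreover \<open>(\<nabla>\<^sub>X J) Y\<close> at a point depends only on the values of \<open>X\<close> and \<open>Y\<close> there.\<close>

lemma partial_deriv_gram_sym:
  assumes "open S" "x \<in> S" and sym: "\<And>y u v. y \<in> S \<Longrightarrow> G y u v = G y v u"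
  shows "partial_deriv l (\<lambda>y. gram G y $ i $ j) x = partial_deriv l (\<lambda>y. gram G y $ j $ i) x"
proof -
  have "((\<lambda>y. gram G y $ j $ i) has_derivative D) (at x)"
    if "((\<lambda>y. gram G y $ i $ j) has_derivative D) (at x)" for D i j
    by (rule has_derivative_transform_within_open[OF that assms(1,2)]) (simp add: gram_def sym)
  then have "((\<lambda>y. gram G y $ i $ j) has_derivative D) (at x) \<longleftrightarrow>
             ((\<lambda>y. gram G y $ j $ i) has_derivative D) (at x)" for D
    by blast
  then show ?thesis
    by (simp add: partial_deriv_def frechet_derivative_def)
qed

lemma cov_deriv_torsion_free:
  assumes "open S" "x \<in> S" and sym: "\<And>y u v. y \<in> S \<Longrightarrow> G y u v = G y v u"
  shows "cov_deriv G X Y x - cov_deriv G Y X x = lie_bracket X Y x"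
proof -
  have gs: "partial_deriv l (\<lambda>y. gram G y $ i $ j) x = partial_deriv l (\<lambda>y. gram G y $ j $ i) x" for l i j
    using assms by (rule partial_deriv_gram_sym)
  have cs: "christoffel G k i j x = christoffel G k j i x" for k i j
    unfolding christoffel_def by (simp add: gs[of _ i j] add.commute)
  have "(\<Sum>i\<in>UNIV. \<Sum>j\<in>UNIV. christoffel G k i j x * X x $ i * Y x $ j) =
        (\<Sum>i\<in>UNIV. \<Sum>j\<in>UNIV. christoffel G k i j x * Y x $ i * X x $ j)" for k
    by (subst sum.swap) (simp add: cs[of k] mult.commute mult.left_commute)
  then show ?thesis
    by (simp add: cov_deriv_def lie_bracket_def)
qed

lemma bilinear_gram:
  fixes G :: "real ^ 'n \<Rightarrow> real ^ 'n \<Rightarrow> real ^ 'n::finite \<Rightarrow> real"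
  assumes "bilinear (G y)"
  shows "G y u v = (\<Sum>i\<in>UNIV. \<Sum>j\<in>UNIV. gram G y $ i $ j * u $ i * v $ j)"
proof -
  have "G y u v = G y (\<Sum>i\<in>UNIV. u $ i *\<^sub>R axis i 1) (\<Sum>j\<in>UNIV. v $ j *\<^sub>R axis j 1)"
    using basis_expansion[of u] basis_expansion[of v] by (simp add: scalar_mult_eq_scaleR)
  also have "\<dots> = (\<Sum>(i,j)\<in>UNIV\<times>UNIV. G y (u $ i *\<^sub>R axis i 1) (v $ j *\<^sub>R axis j 1))"
    by (rule bilinear_sum[OF assms])
  also have "\<dots> = (\<Sum>i\<in>UNIV. \<Sum>j\<in>UNIV. gram G y $ i $ j * u $ i * v $ j)"
    unfolding sum.cartesian_product[symmetric]
    by (simp add: gram_def bilinear_lmul[OF assms] bilinear_rmul[OF assms] mult.left_commute mult.commute)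
  finally show ?thesis .
qed

lemma cov_deriv_metric:
  fixes G :: "real ^ 'n \<Rightarrow> real ^ 'n \<Rightarrow> real ^ 'n::finite \<Rightarrow> real"
  assumes S: "open S" "x \<in> S"
    and bil: "\<And>y. y \<in> S \<Longrightarrow> bilinear (G y)"
    and sym: "\<And>y u v. y \<in> S \<Longrightarrow> G y u v = G y v u"
    and nondeg: "invertible (gram G x)"
    and dG: "\<And>u v. (\<lambda>y. G y u v) differentiable (at x)"
    and dY: "Y differentiable (at x)" and dZ: "Z differentiable (at x)"
  shows "frechet_derivative (\<lambda>y. G y (Y y) (Z y)) (at x) (X x) =
    G x (cov_deriv G X Y x) (Z x) + G x (Y x) (cov_deriv G X Z x)"
proof -
  let ?D = "\<lambda>l i j. partial_deriv l (\<lambda>y. gram G y $ i $ j) x"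
  have gs: "?D l i j = ?D l j i" for l i j
    using S sym by (rule partial_deriv_gram_sym)
  have gsx: "gram G x $ i $ j = gram G x $ j $ i" for i j
    using sym[OF S(2)] by (simp add: gram_def)
  have inv: "(\<Sum>k\<in>UNIV. gram G x $ m $ k * matrix_inv (gram G x) $ k $ l) = (if m = l then 1 else 0)" for m l
  proof -
    have "(gram G x ** matrix_inv (gram G x)) $ m $ l = (mat 1 :: real^'n^'n) $ m $ l"
      using someI_ex[OF nondeg[unfolded invertible_def]] by (simp add: matrix_inv_def)
    then show ?thesis by (simp add: matrix_matrix_mult_def mat_def)
  qed
  have low: "(\<Sum>k\<in>UNIV. gram G x $ m $ k * christoffel G k i j x) = (1/2) * (?D i j m + ?D j i m - ?D m i j)" for m i j
  proof -
    have "(\<Sum>k\<in>UNIV. gram G x $ m $ k * christoffel G k i j x) =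
       (1/2) * (\<Sum>k\<in>UNIV. \<Sum>l\<in>UNIV. gram G x $ m $ k * matrix_inv (gram G x) $ k $ l * (?D i j l + ?D j i l - ?D l i j))"
      unfolding christoffel_def sum_distrib_left by (simp only: mult.assoc mult.left_commute)
    also have "\<dots> = (1/2) * (\<Sum>l\<in>UNIV. (\<Sum>k\<in>UNIV. gram G x $ m $ k * matrix_inv (gram G x) $ k $ l) * (?D i j l + ?D j i l - ?D l i j))"
      by (subst sum.swap) (simp add: sum_distrib_right)
    also have "\<dots> = (1/2) * (?D i j m + ?D j i m - ?D m i j)"
      by (simp add: inv if_distrib[of "\<lambda>t. t * _"] cong: if_cong)
    finally show ?thesis .
  qed
  have met: "?D l i j = (\<Sum>k\<in>UNIV. gram G x $ j $ k * christoffel G k l i x) + (\<Sum>k\<in>UNIV. gram G x $ i $ k * christoffel G k l j x)" for l i j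
    unfolding low using gs[of l j i] gs[of i l j] gs[of j l i] by argo
  let ?dY = "frechet_derivative Y (at x)" and ?dZ = "frechet_derivative Z (at x)"
  have hY: "(Y has_derivative ?dY) (at x)" and hZ: "(Z has_derivative ?dZ) (at x)"
    using dY dZ by (simp_all add: frechet_derivative_works)
  have hY': "((\<lambda>y. Y y $ i) has_derivative (\<lambda>h. ?dY h $ i)) (at x)" for i
    using hY by (rule bounded_linear.has_derivative[OF bounded_linear_vec_nth])
  have hZ': "((\<lambda>y. Z y $ i) has_derivative (\<lambda>h. ?dZ h $ i)) (at x)" for i
    using hZ by (rule bounded_linear.has_derivative[OF bounded_linear_vec_nth])
  have hG: "((\<lambda>y. gram G y $ i $ j) has_derivative frechet_derivative (\<lambda>y. gram G y $ i $ j) (at x)) (at x)" for i j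
    using dG[of "axis i 1" "axis j 1"] by (simp add: gram_def frechet_derivative_works)
  have DG: "frechet_derivative (\<lambda>y. gram G y $ i $ j) (at x) h = (\<Sum>l\<in>UNIV. h $ l * ?D l i j)" for i j h
  proof -
    have lin: "linear (frechet_derivative (\<lambda>y. gram G y $ i $ j) (at x))"
      using hG has_derivative_linear by blast
    have "frechet_derivative (\<lambda>y. gram G y $ i $ j) (at x) h
      = frechet_derivative (\<lambda>y. gram G y $ i $ j) (at x) (\<Sum>l\<in>UNIV. h $ l *\<^sub>R axis l 1)"
      using basis_expansion[of h] by (simp add: scalar_mult_eq_scaleR)
    then show ?thesis
      by (simp add: linear_sum[OF lin] linear_cmul[OF lin] partial_deriv_def)
  qed
  let ?g = "\<lambda>i j. gram G x $ i $ j"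
  let ?f = "\<lambda>y. \<Sum>i\<in>UNIV. \<Sum>j\<in>UNIV. gram G y $ i $ j * Y y $ i * Z y $ j"
  let ?d = "\<lambda>h. \<Sum>i\<in>UNIV. \<Sum>j\<in>UNIV. (\<Sum>l\<in>UNIV. h $ l * ?D l i j) * Y x $ i * Z x $ j
      + ?g i j * ?dY h $ i * Z x $ j + ?g i j * Y x $ i * ?dZ h $ j"
  have "(?f has_derivative ?d) (at x)"
    by (rule derivative_eq_intros hG hY' hZ' refl | simp)+ (simp add: fun_eq_iff DG algebra_simps)
  then have "((\<lambda>y. G y (Y y) (Z y)) has_derivative ?d) (at x)"
    by (rule has_derivative_transform_within_open[OF _ S]) (rule bilinear_gram[of G, OF bil, symmetric])
  then have L: "frechet_derivative (\<lambda>y. G y (Y y) (Z y)) (at x) (X x) = ?d (X x)"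
    by (simp add: frechet_derivative_at[symmetric])
  let ?C = "\<lambda>V k. \<Sum>l\<in>UNIV. \<Sum>i\<in>UNIV. christoffel G k l i x * X x $ l * V $ i"
  have A: "(\<Sum>k\<in>UNIV. \<Sum>j\<in>UNIV. ?g k j * ?C (Y x) k * Z x $ j) =
     (\<Sum>i\<in>UNIV. \<Sum>j\<in>UNIV. \<Sum>l\<in>UNIV. (\<Sum>k\<in>UNIV. ?g j k * christoffel G k l i x) * X x $ l * Y x $ i * Z x $ j)"
    (is "?L = ?R")
  proof -
    have "?L = (\<Sum>k\<in>UNIV. \<Sum>j\<in>UNIV. \<Sum>l\<in>UNIV. \<Sum>i\<in>UNIV. ?g j k * christoffel G k l i x * X x $ l * Y x $ i * Z x $ j)"
    proof (rule sum.cong[OF refl], rule sum.cong[OF refl])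
      fix k j
      show "?g k j * ?C (Y x) k * Z x $ j =
        (\<Sum>l\<in>UNIV. \<Sum>i\<in>UNIV. ?g j k * christoffel G k l i x * X x $ l * Y x $ i * Z x $ j)"
        by (subst gsx[of k j]) (simp add: sum_distrib_left sum_distrib_right mult.assoc)
    qed
    also have "\<dots> = (\<Sum>j\<in>UNIV. \<Sum>l\<in>UNIV. \<Sum>i\<in>UNIV. \<Sum>k\<in>UNIV. ?g j k * christoffel G k l i x * X x $ l * Y x $ i * Z x $ j)"
      by (subst sum.swap, rule sum.cong[OF refl], subst sum.swap, rule sum.cong[OF refl], rule sum.swap)
    also have "\<dots> = (\<Sum>j\<in>UNIV. \<Sum>i\<in>UNIV. \<Sum>l\<in>UNIV. \<Sum>k\<in>UNIV. ?g j k * christoffel G k l i x * X x $ l * Y x $ i * Z x $ j)"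
      by (rule sum.cong[OF refl], rule sum.swap)
    also have "\<dots> = ?R"
      by (subst sum.swap) (simp add: sum_distrib_right)
    finally show ?thesis .
  qed
  have B: "(\<Sum>i\<in>UNIV. \<Sum>k\<in>UNIV. ?g i k * Y x $ i * ?C (Z x) k) =
     (\<Sum>i\<in>UNIV. \<Sum>j\<in>UNIV. \<Sum>l\<in>UNIV. (\<Sum>k\<in>UNIV. ?g i k * christoffel G k l j x) * X x $ l * Y x $ i * Z x $ j)"
  proof (rule sum.cong[OF refl])
    fix i
    have "(\<Sum>k\<in>UNIV. ?g i k * Y x $ i * ?C (Z x) k) =
      (\<Sum>k\<in>UNIV. \<Sum>l\<in>UNIV. \<Sum>j\<in>UNIV. ?g i k * christoffel G k l j x * X x $ l * Y x $ i * Z x $ j)"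
      by (simp add: sum_distrib_left mult.assoc mult.left_commute)
    also have "\<dots> = (\<Sum>l\<in>UNIV. \<Sum>j\<in>UNIV. \<Sum>k\<in>UNIV. ?g i k * christoffel G k l j x * X x $ l * Y x $ i * Z x $ j)"
      by (subst sum.swap, rule sum.cong[OF refl], rule sum.swap)
    also have "\<dots> = (\<Sum>j\<in>UNIV. \<Sum>l\<in>UNIV. \<Sum>k\<in>UNIV. ?g i k * christoffel G k l j x * X x $ l * Y x $ i * Z x $ j)"
      by (rule sum.swap)
    finally show "(\<Sum>k\<in>UNIV. ?g i k * Y x $ i * ?C (Z x) k) =
      (\<Sum>j\<in>UNIV. \<Sum>l\<in>UNIV. (\<Sum>k\<in>UNIV. ?g i k * christoffel G k l j x) * X x $ l * Y x $ i * Z x $ j)"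
      by (simp add: sum_distrib_right)
  qed
  have C: "(\<Sum>i\<in>UNIV. \<Sum>j\<in>UNIV. (\<Sum>l\<in>UNIV. X x $ l * ?D l i j) * Y x $ i * Z x $ j) =
     (\<Sum>k\<in>UNIV. \<Sum>j\<in>UNIV. ?g k j * ?C (Y x) k * Z x $ j) + (\<Sum>i\<in>UNIV. \<Sum>k\<in>UNIV. ?g i k * Y x $ i * ?C (Z x) k)"
    unfolding A B sum.distrib[symmetric]
  proof (rule sum.cong[OF refl], rule sum.cong[OF refl])
    fix i j
    show "(\<Sum>l\<in>UNIV. X x $ l * ?D l i j) * Y x $ i * Z x $ j =
      (\<Sum>l\<in>UNIV. (\<Sum>k\<in>UNIV. ?g j k * christoffel G k l i x) * X x $ l * Y x $ i * Z x $ j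
        + (\<Sum>k\<in>UNIV. ?g i k * christoffel G k l j x) * X x $ l * Y x $ i * Z x $ j)"
      unfolding sum_distrib_right[of "\<lambda>l. X x $ l * ?D l i j"] sum_distrib_right[of "\<lambda>l. X x $ l * ?D l i j * Y x $ i"]
      by (rule sum.cong[OF refl]) (simp only: met distrib_left distrib_right mult_ac)
  qed
  have R: "G x (cov_deriv G X Y x) (Z x) + G x (Y x) (cov_deriv G X Z x) =
     (\<Sum>i\<in>UNIV. \<Sum>j\<in>UNIV. ?g i j * ?dY (X x) $ i * Z x $ j + ?g i j * Y x $ i * ?dZ (X x) $ j)
     + ((\<Sum>k\<in>UNIV. \<Sum>j\<in>UNIV. ?g k j * ?C (Y x) k * Z x $ j) + (\<Sum>i\<in>UNIV. \<Sum>k\<in>UNIV. ?g i k * Y x $ i * ?C (Z x) k))"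
    unfolding bilinear_gram[of G x, OF bil[OF S(2)]] cov_deriv_def
    by (simp add: sum.distrib distrib_left distrib_right)
  show ?thesis unfolding L R C[symmetric] by (simp add: sum.distrib algebra_simps)
qed

lemma cov_deriv_endo_tensorial:
  fixes J :: "real ^ 'n \<Rightarrow> real ^ 'n \<Rightarrow> real ^ 'n::finite"
  assumes S: "open S" "x \<in> S"
    and lin: "\<And>y. y \<in> S \<Longrightarrow> linear (J y)"
    and dJ: "\<And>u. (\<lambda>y. J y u) differentiable (at x)"
    and dY: "Y differentiable (at x)"
  shows "cov_deriv_endo G J X Y x = cov_deriv_endo G J (\<lambda>_. X x) (\<lambda>_. Y x) x"
proof -
  let ?dY = "frechet_derivative Y (at x)"
  let ?DJ = "\<lambda>u. frechet_derivative (\<lambda>y. J y u) (at x)"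
  have exp: "J y u = (\<Sum>i\<in>UNIV. u $ i *\<^sub>R J y (axis i 1))" if "y \<in> S" for y u
  proof -
    have "J y u = J y (\<Sum>i\<in>UNIV. u $ i *\<^sub>R axis i 1)"
      using basis_expansion[of u] by (simp add: scalar_mult_eq_scaleR)
    then show ?thesis by (simp add: linear_sum[OF lin[OF that]] linear_cmul[OF lin[OF that]])
  qed
  have hY: "((\<lambda>y. Y y $ i) has_derivative (\<lambda>h. ?dY h $ i)) (at x)" for i
    using dY unfolding frechet_derivative_works by (rule bounded_linear.has_derivative[OF bounded_linear_vec_nth])
  have hJ: "((\<lambda>y. J y u) has_derivative ?DJ u) (at x)" for u
    using dJ by (simp add: frechet_derivative_works)
  have h1: "((\<lambda>y. \<Sum>i\<in>UNIV. Y y $ i *\<^sub>R J y (axis i 1)) has_derivative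
     (\<lambda>h. \<Sum>i\<in>UNIV. Y x $ i *\<^sub>R ?DJ (axis i 1) h + ?dY h $ i *\<^sub>R J x (axis i 1))) (at x)"
    by (intro has_derivative_sum has_derivative_scaleR hY hJ)
  have h2: "((\<lambda>y. \<Sum>i\<in>UNIV. Y x $ i *\<^sub>R J y (axis i 1)) has_derivative
     (\<lambda>h. \<Sum>i\<in>UNIV. Y x $ i *\<^sub>R ?DJ (axis i 1) h)) (at x)"
    by (intro has_derivative_sum has_derivative_scaleR_right hJ)
  have "((\<lambda>y. J y (Y y)) has_derivative
     (\<lambda>h. \<Sum>i\<in>UNIV. Y x $ i *\<^sub>R ?DJ (axis i 1) h + ?dY h $ i *\<^sub>R J x (axis i 1))) (at x)"
    by (rule has_derivative_transform_within_open[OF h1 S]) (simp add: exp[symmetric])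
  moreover have "((\<lambda>y. J y (Y x)) has_derivative (\<lambda>h. \<Sum>i\<in>UNIV. Y x $ i *\<^sub>R ?DJ (axis i 1) h)) (at x)"
    by (rule has_derivative_transform_within_open[OF h2 S]) (simp add: exp[symmetric])
  ultimately have "frechet_derivative (\<lambda>y. J y (Y y)) (at x) h =
      frechet_derivative (\<lambda>y. J y (Y x)) (at x) h + J x (?dY h)" for h
    by (simp add: frechet_derivative_at[symmetric] sum.distrib exp[OF S(2), symmetric])
  then show ?thesis
    by (simp add: cov_deriv_endo_def cov_deriv_def linear_add[OF lin[OF S(2)]])
qed


section \<open>Nearly pseudo-Kaehler manifolds\<close>

text \<open>The tangent vector \<open>(\<nabla>\<^sub>v J) w\<close> at \<open>p\<close>, computed in the chart \<open>c\<close> around \<open>p\<close>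
  with the extensions of \<open>v\<close> and \<open>w\<close> that are constant in this chart (see
  \<open>cov_deriv_endo_tensorial\<close>). Mathematically it does not depend on \<open>c\<close>; the notions
  below, as well as the Einstein condition, quantify over all charts around a point.\<close>

definition nabla_J :: "('a, 'n::finite) chart set \<Rightarrow> ('a, 'n) tmetric \<Rightarrow> ('a, 'n) tendo
    \<Rightarrow> ('a, 'n) chart \<Rightarrow> 'a \<Rightarrow> ('a, 'n) tvector \<Rightarrow> ('a, 'n) tvector \<Rightarrow> ('a, 'n) tvector" where
  "nabla_J A g J c p v w = tangent_of A c p
     (cov_deriv_endo (local_metric A g c) (local_endo A J c) (\<lambda>_. v c) (\<lambda>_. w c) (snd c p))"

definition nearly_pseudo_kaehler ::
    "'a topology \<Rightarrow> ('a, 'n::finite) chart set \<Rightarrow> ('a, 'n) tmetric \<Rightarrow> ('a, 'n) tendo \<Rightarrow> bool" where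
  "nearly_pseudo_kaehler M A g J \<longleftrightarrow>
     almost_pseudo_hermitian M A g J \<and>
     (\<forall>p\<in>topspace M. \<forall>c\<in>A. p \<in> fst c \<longrightarrow>
        (\<forall>v\<in>tangent_space A p. nabla_J A g J c p v v = (\<lambda>_. 0)))"

definition strict_nearly_pseudo_kaehler ::
    "'a topology \<Rightarrow> ('a, 'n::finite) chart set \<Rightarrow> ('a, 'n) tmetric \<Rightarrow> ('a, 'n) tendo \<Rightarrow> bool" where
  "strict_nearly_pseudo_kaehler M A g J \<longleftrightarrow>
     nearly_pseudo_kaehler M A g J \<and>
     (\<forall>p\<in>topspace M. \<forall>c\<in>A. p \<in> fst c \<longrightarrow>
        (\<forall>v\<in>tangent_space A p. v \<noteq> (\<lambda>_. 0) \<longrightarrow>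
          (\<exists>w\<in>tangent_space A p. nabla_J A g J c p v w \<noteq> (\<lambda>_. 0))))"

definition constant_type :: "'a topology \<Rightarrow> ('a, 'n::finite) chart set \<Rightarrow> ('a, 'n) tmetric
    \<Rightarrow> ('a, 'n) tendo \<Rightarrow> real \<Rightarrow> bool" where
  "constant_type M A g J \<alpha> \<longleftrightarrow>
     (\<forall>p\<in>topspace M. \<forall>c\<in>A. p \<in> fst c \<longrightarrow>
        (\<forall>v\<in>tangent_space A p. \<forall>w\<in>tangent_space A p.
          g p (nabla_J A g J c p v w) (nabla_J A g J c p v w) =
          \<alpha> * (g p v v * g p w w - (g p v w)\<^sup>2 - (g p (J p v) w)\<^sup>2)))"

definition pseudo_riemannian_einstein :: "'a topology \<Rightarrow> ('a, 'n::finite) chart set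
    \<Rightarrow> ('a, 'n) tmetric \<Rightarrow> real \<Rightarrow> bool" where
  "pseudo_riemannian_einstein M A g k \<longleftrightarrow>
     pseudo_riemannian_metric M A g \<and>
     (\<forall>p\<in>topspace M. \<forall>c\<in>A. p \<in> fst c \<longrightarrow>
        (\<forall>v\<in>tangent_space A p. \<forall>w\<in>tangent_space A p.
          ricci (local_metric A g c) (snd c p) (v c) (w c) = k * g p v w))"

end

theory Submission
  imports Defs
begin

text \<open>Write \<open>A u = \<nabla>\<^sub>u J\<close>. In a nearly pseudo-Kaehler manifold \<open>g (A u v) w\<close> is alternating, and each
  \<open>A u\<close> anticommutes with \<open>J\<close>. The Einstein equation comes from three facts about the curvature.

  First, \<open>A\<close> is parallel for the canonical Hermitian connection \<open>\<nabla> - (1/2) J (\<nabla>J)\<close>. This is the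
  algebraic formula \<open>B_eq\<close> for \<open>\<nabla>A\<close>: the derivative of \<open>A u (J v) = - J (A u v)\<close> determines
  the part of \<open>\<nabla>A\<close> of mixed type, and the Ricci identity for \<open>J\<close> together with the first Bianchi
  identity determines the part of type (3,0)+(0,3). Inserting the formula back into the Ricci
  identity gives \<open>[R w x, J]\<close> in terms of \<open>A\<close> (\<open>R_J\<close>).

  Second, as second derivatives commute, the curvature \<open>N\<close> of the canonical connection annihilates
  \<open>A\<close> (\<open>N_annihilates\<close>), and by \<open>B_eq\<close> it differs from the Levi-Civita curvature only by terms
  quadratic in \<open>A\<close> (\<open>N_eq\<close>). In six dimensions \<open>A\<close> is the real part of a complex volume form, so
  a skew endomorphism annihilating \<open>A\<close> has no complex trace (\<open>tr_annihilator\<close>). The proof uses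
  constant type in place of complex coordinates and needs \<open>\<alpha> \<noteq> 0\<close>; this follows from strictness
  (\<open>constant_type_nonzero\<close>).

  Third, \<open>tr (A u \<circ> A v) = - 4 \<alpha> g u v\<close> in dimension six (\<open>tr_A_A\<close>), which evaluates all the
  quadratic terms. So \<open>tr (J \<circ> R u w) = 2 \<alpha> g (J u) w\<close>. The Bianchi identity turns this into the
  trace of \<open>y \<mapsto> J (R y u w)\<close>, and exchanging \<open>J\<close> with the curvature by \<open>R_J\<close> replaces this *-Ricci
  tensor \<open>\<alpha> g\<close> by the Ricci tensor \<open>\<alpha> g + 4 \<alpha> g\<close>.

  All tensors are evaluated on fields that are constant in a chart, where \<open>\<nabla>\<^sub>u\<close> is the directional
  derivative plus the Christoffel term \<open>Gam p u\<close>; the identities above are then obtained by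
  differentiating the defining ones with the product rule.\<close>

section \<open>Calculus of smooth maps\<close>

lemma Ck_on_cong:
  assumes "open S" "\<And>x. x \<in> S \<Longrightarrow> f x = h x"
  shows "Ck_on k S f \<longleftrightarrow> Ck_on k S h"
proof -
  have imp: "Ck_on k S f \<Longrightarrow> Ck_on k S h" if "\<And>x. x \<in> S \<Longrightarrow> f x = h x" for f h :: "'a \<Rightarrow> 'b"
    using that
  proof (induction k arbitrary: f h)
    case 0
    then show ?case by (simp cong: continuous_on_cong)
  next
    case (Suc k)
    have d: "h differentiable (at x)" if "x \<in> S" for x
      using Suc.prems that \<open>open S\<close>
      by (metis Ck_on.simps(2) differentiable_def has_derivative_transform_within_open)
    have e: "frechet_derivative f (at x) v = frechet_derivative h (at x) v" if "x \<in> S" for x v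
      using Suc.prems that frechet_derivative_transform_within_open[of f x S h] \<open>open S\<close> by simp
    have "Ck_on k S (\<lambda>x. frechet_derivative h (at x) v)" for v
      using Suc.IH[of "\<lambda>x. frechet_derivative f (at x) v" "\<lambda>x. frechet_derivative h (at x) v"]
        e Suc.prems(1) by simp
    with d show ?case by simp
  qed
  show ?thesis using imp[of f h] imp[of h f] assms(2) by auto
qed

lemma Ck_on_SucD: "Ck_on (Suc k) S f \<Longrightarrow> Ck_on k S f"
proof (induction k arbitrary: f)
  case 0
  then show ?case
    by (auto intro!: continuous_at_imp_continuous_on differentiable_imp_continuous_within)
next
  case (Suc k)
  have "Ck_on (Suc k) S (\<lambda>x. frechet_derivative f (at x) v)" for v
    using Suc.prems Ck_on.simps(2)[of "Suc k"] by blast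
  then have "Ck_on k S (\<lambda>x. frechet_derivative f (at x) v)" for v
    by (rule Suc.IH)
  then show ?case
    using Suc.prems Ck_on.simps(2) by blast
qed

lemma Ck_on_const: "Ck_on k S (\<lambda>_. c)"
  by (induction k arbitrary: c) auto

lemma Ck_on_add:
  assumes "open S" "Ck_on k S f" "Ck_on k S h"
  shows "Ck_on k S (\<lambda>x. f x + h x)"
  using assms(2,3)
proof (induction k arbitrary: f h)
  case 0
  then show ?case by (simp add: continuous_on_add)
next
  case (Suc k)
  have e: "frechet_derivative (\<lambda>x. f x + h x) (at x) v =
      frechet_derivative f (at x) v + frechet_derivative h (at x) v" if "x \<in> S" for x v
    using Suc.prems that frechet_derivative_at[OF has_derivative_add, of f _ x h]
    by (simp add: frechet_derivative_works fun_eq_iff)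
  have "Ck_on k S (\<lambda>x. frechet_derivative (\<lambda>x. f x + h x) (at x) v)" for v
    using Suc.IH[of "\<lambda>x. frechet_derivative f (at x) v" "\<lambda>x. frechet_derivative h (at x) v"]
      Suc.prems Ck_on_cong[OF \<open>open S\<close> e] by simp
  with Suc.prems show ?case by simp
qed

lemma frechet_derivative_bounded_bilinear:
  assumes "bounded_bilinear b" "f differentiable (at x)" "h differentiable (at x)"
  shows "frechet_derivative (\<lambda>x. b (f x) (h x)) (at x) v =
      b (f x) (frechet_derivative h (at x) v) + b (frechet_derivative f (at x) v) (h x)"
  by (rule frechet_derivative_at[OF bounded_bilinear.FDERIV[OF assms(1) assms(2,3)[unfolded
        frechet_derivative_works]], symmetric, THEN fun_cong])

lemma Ck_on_bounded_bilinear: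
  assumes "open S" "bounded_bilinear b" "Ck_on k S f" "Ck_on k S h"
  shows "Ck_on k S (\<lambda>x. b (f x) (h x))"
  using assms(3,4)
proof (induction k arbitrary: f h)
  case 0
  then show ?case using assms(2) by (simp add: bounded_bilinear.continuous_on)
next
  case (Suc k)
  have df: "f differentiable (at x)" "h differentiable (at x)" if "x \<in> S" for x
    using Suc.prems that by auto
  then have d: "(\<lambda>x. b (f x) (h x)) differentiable (at x)" if "x \<in> S" for x
    using bounded_bilinear.FDERIV[OF assms(2) df[OF that, unfolded frechet_derivative_works]]
    by (auto simp: differentiable_def)
  have "Ck_on k S (\<lambda>x. b (f x) (frechet_derivative h (at x) v) + b (frechet_derivative f (at x) v) (h x))" for v
    using Suc.prems Ck_on_SucD[OF Suc.prems(1)] Ck_on_SucD[OF Suc.prems(2)]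
    by (intro Ck_on_add[OF assms(1)] Suc.IH) simp_all
  then have "Ck_on k S (\<lambda>x. frechet_derivative (\<lambda>x. b (f x) (h x)) (at x) v)" for v
    by (rule Ck_on_cong[OF assms(1), THEN iffD2, rotated])
       (rule frechet_derivative_bounded_bilinear[OF assms(2) df])
  then show ?case unfolding Ck_on.simps(2) using d by blast
qed

lemma Ck_on_inverse:
  fixes f :: "'a::real_normed_vector \<Rightarrow> real"
  assumes "open S" "\<And>x. x \<in> S \<Longrightarrow> f x \<noteq> 0" "Ck_on k S f"
  shows "Ck_on k S (\<lambda>x. inverse (f x))"
  using assms(3)
proof (induction k)
  case 0
  then show ?case using assms(2) by (simp add: continuous_on_inverse)
next
  case (Suc k)
  have h: "((\<lambda>x. inverse (f x)) has_derivative
      (\<lambda>v. - (inverse (f x) * frechet_derivative f (at x) v * inverse (f x)))) (at x)" if "x \<in> S" for x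
  proof (rule Deriv.has_derivative_inverse[where f = f, OF assms(2)[OF that]])
    show "(f has_derivative frechet_derivative f (at x)) (at x)"
      using Suc.prems that by (simp add: frechet_derivative_works)
  qed
  have k: "Ck_on k S (\<lambda>x. inverse (f x))"
    using Suc.IH Ck_on_SucD[OF Suc.prems] by simp
  have D: "Ck_on k S (\<lambda>x. (- 1) * (inverse (f x) * frechet_derivative f (at x) v * inverse (f x)))" for v
  proof -
    have "Ck_on k S (\<lambda>x. frechet_derivative f (at x) v)" using Suc.prems by simp
    then show ?thesis
      by (intro Ck_on_bounded_bilinear[OF assms(1) bounded_bilinear_mult] Ck_on_const k)
  qed
  have "Ck_on k S (\<lambda>x. frechet_derivative (\<lambda>x. inverse (f x)) (at x) v)" for v
    using D[of v]
    by (rule Ck_on_cong[OF assms(1), THEN iffD2, rotated])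
       (simp add: frechet_derivative_at[OF h, symmetric])
  then show ?case unfolding Ck_on.simps(2) differentiable_def using h by blast
qed

lemma Ck_on_bounded_linear:
  assumes "open S" "bounded_linear L" "Ck_on k S f"
  shows "Ck_on k S (\<lambda>x. L (f x))"
  using assms(3)
proof (induction k arbitrary: f)
  case 0
  then show ?case using assms(2) by (simp add: bounded_linear.continuous_on)
next
  case (Suc k)
  have h: "((\<lambda>x. L (f x)) has_derivative (\<lambda>v. L (frechet_derivative f (at x) v))) (at x)" if "x \<in> S" for x
    using Suc.prems that by (intro bounded_linear.has_derivative[OF assms(2)]) (simp add: frechet_derivative_works)
  have D: "Ck_on k S (\<lambda>x. L (frechet_derivative f (at x) v))" for v
    using Suc.IH[of "\<lambda>x. frechet_derivative f (at x) v"] Suc.prems by simp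
  have "Ck_on k S (\<lambda>x. frechet_derivative (\<lambda>x. L (f x)) (at x) v)" for v
    using D[of v]
    by (rule Ck_on_cong[OF assms(1), THEN iffD2, rotated])
       (simp add: frechet_derivative_at[OF h, symmetric])
  then show ?case unfolding Ck_on.simps(2) differentiable_def using h by blast
qed

lemma smooth_on_cong:
  "open S \<Longrightarrow> (\<And>x. x \<in> S \<Longrightarrow> f x = h x) \<Longrightarrow> smooth_on S f \<longleftrightarrow> smooth_on S h"
  unfolding smooth_on_def by (simp cong: Ck_on_cong)

lemma smooth_on_const: "smooth_on S (\<lambda>_. c)"
  by (simp add: smooth_on_def Ck_on_const)

lemma smooth_on_add:
  "open S \<Longrightarrow> smooth_on S f \<Longrightarrow> smooth_on S h \<Longrightarrow> smooth_on S (\<lambda>x. f x + h x)"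
  by (simp add: smooth_on_def Ck_on_add)

lemma smooth_on_bounded_bilinear:
  "open S \<Longrightarrow> bounded_bilinear b \<Longrightarrow> smooth_on S f \<Longrightarrow> smooth_on S h \<Longrightarrow> smooth_on S (\<lambda>x. b (f x) (h x))"
  by (simp add: smooth_on_def Ck_on_bounded_bilinear)

lemmas smooth_on_mult = smooth_on_bounded_bilinear[OF _ bounded_bilinear_mult]
lemmas smooth_on_scaleR = smooth_on_bounded_bilinear[OF _ bounded_bilinear_scaleR]

lemma smooth_on_bounded_linear:
  "open S \<Longrightarrow> bounded_linear L \<Longrightarrow> smooth_on S f \<Longrightarrow> smooth_on S (\<lambda>x. L (f x))"
  by (simp add: smooth_on_def Ck_on_bounded_linear)

lemma smooth_on_diff:
  assumes "open S" "smooth_on S f" "smooth_on S h"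
  shows "smooth_on S (\<lambda>x. f x - h x)"
  using smooth_on_add[OF assms(1,2) smooth_on_bounded_linear[OF assms(1) _ assms(3), of uminus]]
  by (simp add: bounded_linear_minus bounded_linear_ident)

lemma smooth_on_inverse:
  fixes f :: "'a::real_normed_vector \<Rightarrow> real"
  shows "open S \<Longrightarrow> (\<And>x. x \<in> S \<Longrightarrow> f x \<noteq> 0) \<Longrightarrow> smooth_on S f \<Longrightarrow> smooth_on S (\<lambda>x. inverse (f x))"
  by (simp add: smooth_on_def Ck_on_inverse)

lemma smooth_on_sum:
  assumes "open S" "\<And>i. i \<in> I \<Longrightarrow> smooth_on S (f i)"
  shows "smooth_on S (\<lambda>x. \<Sum>i\<in>I. f i x)"
  using assms(2) by (induction I rule: infinite_finite_induct)
    (auto intro: smooth_on_const smooth_on_add[OF assms(1)])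

lemma smooth_on_prod:
  fixes f :: "'i \<Rightarrow> 'a::real_normed_vector \<Rightarrow> real"
  assumes "open S" "\<And>i. i \<in> I \<Longrightarrow> smooth_on S (f i)"
  shows "smooth_on S (\<lambda>x. \<Prod>i\<in>I. f i x)"
  using assms(2) by (induction I rule: infinite_finite_induct)
    (auto intro: smooth_on_const smooth_on_mult[OF assms(1)])

lemma smooth_on_det:
  fixes F :: "'a::real_normed_vector \<Rightarrow> real ^ 'n ^ 'n::finite"
  assumes "open S" "\<And>i j. smooth_on S (\<lambda>x. F x $ i $ j)"
  shows "smooth_on S (\<lambda>x. det (F x))"
  unfolding det_def
  by (intro smooth_on_sum smooth_on_mult smooth_on_prod smooth_on_const assms)

lemma smooth_on_differentiable: "smooth_on S f \<Longrightarrow> x \<in> S \<Longrightarrow> f differentiable (at x)"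
  unfolding smooth_on_def using Ck_on.simps(2) by blast

lemma smooth_on_frechet_derivative: "smooth_on S f \<Longrightarrow> smooth_on S (\<lambda>x. frechet_derivative f (at x) v)"
  unfolding smooth_on_def using Ck_on.simps(2) by blast

lemma smooth_on_continuous: "smooth_on S f \<Longrightarrow> continuous_on S f"
  unfolding smooth_on_def using Ck_on.simps(1) by blast

text \<open>Cramer's rule writes the entries of the inverse as quotients of determinants.\<close>

lemma smooth_on_matrix_inv:
  fixes F :: "'a::real_normed_vector \<Rightarrow> real ^ 'n ^ 'n::finite"
  assumes S: "open S" and F: "\<And>i j. smooth_on S (\<lambda>x. F x $ i $ j)"
    and inv: "\<And>x. x \<in> S \<Longrightarrow> invertible (F x)"
  shows "smooth_on S (\<lambda>x. matrix_inv (F x) $ k $ l)"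
proof -
  let ?M = "\<lambda>x. \<chi> i j. if j = k then axis l 1 $ i else F x $ i $ j"
  have eq: "matrix_inv (F x) $ k $ l = det (?M x) * inverse (det (F x))" if "x \<in> S" for x
  proof -
    have d: "det (F x) \<noteq> 0" using inv[OF that] by (simp add: invertible_det_nz)
    have i: "F x ** matrix_inv (F x) = mat 1"
      using someI_ex[OF inv[OF that, unfolded invertible_def]] by (simp add: matrix_inv_def)
    have "F x *v (matrix_inv (F x) *v axis l 1) = axis l 1"
      by (simp add: matrix_vector_mul_assoc i)
    from this[unfolded cramer[OF d]]
    have "(matrix_inv (F x) *v axis l 1) $ k = det (?M x) / det (F x)" by simp
    then show ?thesis by (simp add: matrix_vector_mul_component inner_axis divide_inverse)
  qed
  have "smooth_on S (\<lambda>x. ?M x $ i $ j)" for i j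
    using F by (cases "j = k") (simp_all add: smooth_on_const)
  then have "smooth_on S (\<lambda>x. det (?M x) * inverse (det (F x)))"
    using inv by (intro smooth_on_mult smooth_on_inverse smooth_on_det S F) (auto simp: invertible_det_nz)
  then show ?thesis using smooth_on_cong[OF S eq] by simp
qed

section \<open>Symmetry of second derivatives\<close>

text \<open>The mean value theorem for \<open>t \<mapsto> f (x + t *\<^sub>R u + s *\<^sub>R v) - f (x + t *\<^sub>R u)\<close>, followed by the
  mean value theorem in the direction \<open>v\<close>. The left-hand side is symmetric in \<open>u\<close> and \<open>v\<close>, which is
  why the second derivative is.\<close>

lemma second_difference_eq:
  fixes f :: "'a::real_normed_vector \<Rightarrow> real"
  assumes s: "0 < s"
    and in1: "\<And>a b. 0 \<le> a \<Longrightarrow> a \<le> s \<Longrightarrow> 0 \<le> b \<Longrightarrow> b \<le> s \<Longrightarrow> x + a *\<^sub>R u + b *\<^sub>R v \<in> S"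
    and df: "\<And>y. y \<in> S \<Longrightarrow> f differentiable (at y)"
    and ddf: "\<And>y. y \<in> S \<Longrightarrow> (\<lambda>z. frechet_derivative f (at z) u) differentiable (at y)"
  obtains a b where "0 \<le> a" "a \<le> s" "0 \<le> b" "b \<le> s"
    "f (x + s *\<^sub>R u + s *\<^sub>R v) - f (x + s *\<^sub>R u) - f (x + s *\<^sub>R v) + f x =
      s * s * frechet_derivative (\<lambda>z. frechet_derivative f (at z) u) (at (x + a *\<^sub>R u + b *\<^sub>R v)) v"
proof -
  let ?D = "\<lambda>y. frechet_derivative f (at y) u"
  let ?\<phi> = "\<lambda>a. f (x + a *\<^sub>R u + s *\<^sub>R v) - f (x + a *\<^sub>R u)"
  have line: "((\<lambda>t. h (y + t *\<^sub>R w)) has_derivative (\<lambda>r. r * frechet_derivative h (at (y + t *\<^sub>R w)) w)) (at t)"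
    if "h differentiable (at (y + t *\<^sub>R w))" for h :: "'a \<Rightarrow> real" and y w t
  proof -
    have "((\<lambda>t. h (y + t *\<^sub>R w)) has_derivative (\<lambda>r. frechet_derivative h (at (y + t *\<^sub>R w)) (r *\<^sub>R w))) (at t)"
      by (rule has_derivative_compose[of "\<lambda>t. y + t *\<^sub>R w"])
         (auto intro!: derivative_eq_intros that[unfolded frechet_derivative_works])
    then show ?thesis
      using linear_frechet_derivative[OF that] by (simp add: linear_cmul)
  qed
  have in0: "x + a *\<^sub>R u \<in> S" if "0 \<le> a" "a \<le> s" for a
    using in1[of a 0] that s by simp
  have "\<exists>a\<in>{0<..<s}. ?\<phi> s - ?\<phi> 0 = (s - 0) * (?D (x + a *\<^sub>R u + s *\<^sub>R v) - ?D (x + a *\<^sub>R u))"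
  proof (rule mvt_simple[OF s])
    fix a assume a: "0 \<le> a" "a \<le> s"
    have "((\<lambda>t. f (x + s *\<^sub>R v + t *\<^sub>R u)) has_derivative (\<lambda>r. r * ?D (x + s *\<^sub>R v + a *\<^sub>R u))) (at a)"
      using line[of f "x + s *\<^sub>R v" a u] df in1[of a s] a s by (simp add: algebra_simps)
    moreover have "((\<lambda>t. f (x + t *\<^sub>R u)) has_derivative (\<lambda>r. r * ?D (x + a *\<^sub>R u))) (at a)"
      using line[of f x a u] df in0[of a] a by simp
    ultimately have "(?\<phi> has_derivative (\<lambda>r. r * (?D (x + a *\<^sub>R u + s *\<^sub>R v) - ?D (x + a *\<^sub>R u)))) (at a)"
      using has_derivative_diff by (fastforce simp: algebra_simps)
    then show "(?\<phi> has_derivative (\<lambda>r. r * (?D (x + a *\<^sub>R u + s *\<^sub>R v) - ?D (x + a *\<^sub>R u)))) (at a within {0..s})"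
      by (rule has_derivative_at_withinI)
  qed
  then obtain a where a: "0 < a" "a < s"
      and 1: "?\<phi> s - ?\<phi> 0 = s * (?D (x + a *\<^sub>R u + s *\<^sub>R v) - ?D (x + a *\<^sub>R u))" by auto
  let ?\<psi> = "\<lambda>b. ?D (x + a *\<^sub>R u + b *\<^sub>R v)"
  have "\<exists>b\<in>{0<..<s}. ?\<psi> s - ?\<psi> 0 = (s - 0) * frechet_derivative ?D (at (x + a *\<^sub>R u + b *\<^sub>R v)) v"
  proof (rule mvt_simple[OF s])
    fix b assume b: "0 \<le> b" "b \<le> s"
    show "(?\<psi> has_derivative (\<lambda>r. r * frechet_derivative ?D (at (x + a *\<^sub>R u + b *\<^sub>R v)) v)) (at b within {0..s})"
      using line[of ?D "x + a *\<^sub>R u" b v] ddf in1[of a b] a b by (simp add: has_derivative_at_withinI)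
  qed
  then obtain b where b: "0 < b" "b < s"
      and 2: "?\<psi> s - ?\<psi> 0 = s * frechet_derivative ?D (at (x + a *\<^sub>R u + b *\<^sub>R v)) v" by auto
  show ?thesis
    using that[of a b] a b 1 2 by (simp add: algebra_simps)
qed

lemma frechet_derivative_commute_real:
  fixes f :: "'a::real_normed_vector \<Rightarrow> real"
  assumes S: "open S" "x \<in> S" and f: "smooth_on S f"
  shows "frechet_derivative (\<lambda>z. frechet_derivative f (at z) u) (at x) v =
    frechet_derivative (\<lambda>z. frechet_derivative f (at z) v) (at x) u"
proof -
  define D where "D u v y = frechet_derivative (\<lambda>z. frechet_derivative f (at z) u) (at y) v" for u v y
  have cont: "continuous_on S (D u v)" for u v
    unfolding D_def[abs_def] by (intro smooth_on_continuous smooth_on_frechet_derivative f)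
  obtain r where r: "r > 0" "ball x r \<subseteq> S" using S openE by blast
  have close: "\<bar>D u v x - D v u x\<bar> \<le> e" if "e > 0" for e
  proof -
    have "isCont (D u v) x" "isCont (D v u) x"
      using cont S by (auto simp: continuous_on_eq_continuous_at)
    then have "\<exists>d>0. \<forall>y. dist y x < d \<longrightarrow> dist (D u v y) (D u v x) < e / 2"
      "\<exists>d>0. \<forall>y. dist y x < d \<longrightarrow> dist (D v u y) (D v u x) < e / 2"
      using \<open>e > 0\<close> half_gt_zero unfolding continuous_at_eps_delta by blast+
    then obtain d1 d2 where d1: "d1 > 0" "\<And>y. dist y x < d1 \<Longrightarrow> dist (D u v y) (D u v x) < e / 2"
      and d2: "d2 > 0" "\<And>y. dist y x < d2 \<Longrightarrow> dist (D v u y) (D v u x) < e / 2" by blast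
    define d where "d = min r (min d1 d2)"
    \<comment> \<open>The parallelogram spanned by \<open>s *\<^sub>R u\<close> and \<open>s *\<^sub>R v\<close> stays within distance \<open>d\<close> of \<open>x\<close>;
      the summand 1 keeps the denominator positive when \<open>u\<close> and \<open>v\<close> vanish.\<close>
    define s where "s = d / (2 * (norm u + norm v + 1))"
    have pos: "d > 0" using r d1 d2 by (simp add: d_def)
    have s: "s > 0" using pos by (simp add: s_def add_nonneg_pos)
    have near: "dist (x + a *\<^sub>R u + b *\<^sub>R v) x < d" if "0 \<le> a" "a \<le> s" "0 \<le> b" "b \<le> s" for a b
    proof -
      have "dist (x + a *\<^sub>R u + b *\<^sub>R v) x \<le> a * norm u + b * norm v"
        using norm_triangle_ineq[of "a *\<^sub>R u" "b *\<^sub>R v"] that by (simp add: dist_norm)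
      also have "\<dots> \<le> s * norm u + s * norm v"
        using that by (intro add_mono mult_right_mono) auto
      also have "\<dots> \<le> s * (norm u + norm v + 1)" using s by (simp add: algebra_simps)
      also have "\<dots> = d / 2"
      proof -
        have "norm u + norm v + 1 \<noteq> 0" using norm_ge_zero[of u] norm_ge_zero[of v] by linarith
        moreover have "d / (2 * N) * N = d / 2" if "N \<noteq> 0" for N using that by simp
        ultimately show ?thesis unfolding s_def by blast
      qed
      also have "\<dots> < d" using pos by simp
      finally show ?thesis .
    qed
    have inS: "x + a *\<^sub>R u + b *\<^sub>R v \<in> S" if "0 \<le> a" "a \<le> s" "0 \<le> b" "b \<le> s" for a b
      using near[OF that] r by (auto simp: d_def dist_commute)
    note sm = smooth_on_differentiable[OF f] smooth_on_differentiable[OF smooth_on_frechet_derivative[OF f]]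
    obtain a b where ab: "0 \<le> a" "a \<le> s" "0 \<le> b" "b \<le> s"
      and 1: "f (x + s *\<^sub>R u + s *\<^sub>R v) - f (x + s *\<^sub>R u) - f (x + s *\<^sub>R v) + f x = s * s * D u v (x + a *\<^sub>R u + b *\<^sub>R v)"
      using second_difference_eq[of s x u v S f, OF s inS sm] unfolding D_def by blast
    have inS': "x + a *\<^sub>R v + b *\<^sub>R u \<in> S" if "0 \<le> a" "a \<le> s" "0 \<le> b" "b \<le> s" for a b
      using inS[of b a] that by (simp add: algebra_simps)
    obtain a' b' where ab': "0 \<le> a'" "a' \<le> s" "0 \<le> b'" "b' \<le> s"
      and 2: "f (x + s *\<^sub>R v + s *\<^sub>R u) - f (x + s *\<^sub>R v) - f (x + s *\<^sub>R u) + f x = s * s * D v u (x + a' *\<^sub>R v + b' *\<^sub>R u)"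
      using second_difference_eq[of s x v u S f, OF s inS' sm] unfolding D_def by blast
    have "s * s * D u v (x + a *\<^sub>R u + b *\<^sub>R v) = s * s * D v u (x + b' *\<^sub>R u + a' *\<^sub>R v)"
      using 1 2 by (simp add: algebra_simps)
    then have "D u v (x + a *\<^sub>R u + b *\<^sub>R v) = D v u (x + b' *\<^sub>R u + a' *\<^sub>R v)"
      using s by simp
    moreover have "dist (D u v (x + a *\<^sub>R u + b *\<^sub>R v)) (D u v x) < e / 2"
      using near[OF ab] by (intro d1) (simp add: d_def)
    moreover have "dist (D v u (x + b' *\<^sub>R u + a' *\<^sub>R v)) (D v u x) < e / 2"
      using near[OF ab'(3,4,1,2)] by (intro d2) (simp add: d_def)
    ultimately show ?thesis unfolding dist_real_def by linarith
  qed
  have "\<bar>D u v x - D v u x\<bar> \<le> 0"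
    by (rule field_le_epsilon) (use close in simp)
  then show ?thesis by (simp add: D_def)
qed

lemma frechet_derivative_bounded_linear:
  assumes "bounded_linear L" "f differentiable (at x)"
  shows "frechet_derivative (\<lambda>x. L (f x)) (at x) v = L (frechet_derivative f (at x) v)"
  by (rule frechet_derivative_at[OF bounded_linear.has_derivative[OF assms(1)
        assms(2)[unfolded frechet_derivative_works]], symmetric, THEN fun_cong])

lemma frechet_derivative_commute:
  fixes f :: "'a::real_normed_vector \<Rightarrow> real ^ 'n::finite"
  assumes S: "open S" "x \<in> S" and f: "smooth_on S f"
  shows "frechet_derivative (\<lambda>z. frechet_derivative f (at z) u) (at x) v =
    frechet_derivative (\<lambda>z. frechet_derivative f (at z) v) (at x) u"
proof (rule vec_eq_iff[THEN iffD2], rule allI)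
  fix i
  note bl = bounded_linear_vec_nth[of i]
  have comp: "frechet_derivative (\<lambda>z. frechet_derivative f (at z) u) (at x) v $ i =
    frechet_derivative (\<lambda>z. frechet_derivative (\<lambda>y. f y $ i) (at z) u) (at x) v" for u v
  proof -
    have "frechet_derivative (\<lambda>z. frechet_derivative f (at z) u) (at x) v $ i =
      frechet_derivative (\<lambda>z. frechet_derivative f (at z) u $ i) (at x) v"
      by (rule frechet_derivative_bounded_linear[OF bl, symmetric],
          rule smooth_on_differentiable[OF smooth_on_frechet_derivative[OF f] S(2)])
    also have "\<dots> = frechet_derivative (\<lambda>z. frechet_derivative (\<lambda>y. f y $ i) (at z) u) (at x) v"
    proof (rule fun_cong[OF frechet_derivative_transform_within_open[OF _ S]])
      show "(\<lambda>z. frechet_derivative f (at z) u $ i) differentiable (at x)"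
        by (rule smooth_on_differentiable[OF smooth_on_bounded_linear[OF S(1) bl smooth_on_frechet_derivative[OF f]] S(2)])
      show "frechet_derivative f (at z) u $ i = frechet_derivative (\<lambda>y. f y $ i) (at z) u" if "z \<in> S" for z
        by (rule frechet_derivative_bounded_linear[OF bl smooth_on_differentiable[OF f that], symmetric])
    qed
    finally show ?thesis .
  qed
  show "frechet_derivative (\<lambda>z. frechet_derivative f (at z) u) (at x) v $ i =
    frechet_derivative (\<lambda>z. frechet_derivative f (at z) v) (at x) u $ i"
    unfolding comp
    by (rule frechet_derivative_commute_real[OF S smooth_on_bounded_linear[OF S(1) bl f]])
qed

section \<open>Traces of endomorphisms\<close>

abbreviation tr :: "(real ^ 'n \<Rightarrow> real ^ 'n::finite) \<Rightarrow> real" where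
  "tr f \<equiv> trace (matrix f)"

lemma tr_alt: "tr f = (\<Sum>i\<in>UNIV. f (axis i 1) $ i)"
  by (simp add: trace_def matrix_def)

lemma tr_add: "tr (\<lambda>y. f y + h y) = tr f + tr h"
  by (simp add: tr_alt sum.distrib)

lemma tr_diff: "tr (\<lambda>y. f y - h y) = tr f - tr h"
  by (simp add: tr_alt sum_subtractf)

lemma tr_minus: "tr (\<lambda>y. - f y) = - tr f"
  by (simp add: tr_alt sum_negf)

lemma tr_scaleR: "tr (\<lambda>y. c *\<^sub>R f y) = c * tr f"
  by (simp add: tr_alt sum_distrib_left)

lemma tr_id: "tr (\<lambda>y::real ^ 'n. y) = CARD('n::finite)"
  by (simp add: tr_alt)

lemma linear_axis_expansion:
  fixes f :: "real ^ 'n \<Rightarrow> 'b::real_vector"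
  assumes "linear f"
  shows "f v = (\<Sum>i\<in>UNIV. v $ i *\<^sub>R f (axis i 1))"
proof -
  have "f v = f (\<Sum>i\<in>UNIV. v $ i *\<^sub>R axis i 1)"
    using basis_expansion[of v] by (simp add: scalar_mult_eq_scaleR)
  then show ?thesis by (simp add: linear_sum[OF assms] linear_cmul[OF assms])
qed

lemma tr_rank_one: "linear \<phi> \<Longrightarrow> tr (\<lambda>y. \<phi> y *\<^sub>R v) = \<phi> v"
  using linear_axis_expansion[of \<phi> v] by (simp add: tr_alt mult.commute)

lemma tr_comp_commute:
  fixes f h :: "real ^ 'n \<Rightarrow> real ^ 'n::finite"
  assumes "linear f" "linear h"
  shows "tr (\<lambda>y. f (h y)) = tr (\<lambda>y. h (f y))"
  using matrix_compose[OF assms(2,1)] matrix_compose[OF assms] trace_mul_sym[of "matrix f" "matrix h"]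
  by (simp add: o_def)

lemma bilinear_gram_matrix:
  fixes b :: "real ^ 'n \<Rightarrow> real ^ 'n \<Rightarrow> real"
  assumes "bilinear b"
  shows "b u v = u \<bullet> ((\<chi> i j. b (axis i 1) (axis j 1)) *v v)"
  using bilinear_gram[of "\<lambda>_. b" 0 u v, OF assms]
  by (simp add: gram_def inner_vec_def matrix_vector_mult_def sum_distrib_left mult_ac)

lemma invertible_gram_matrix:
  fixes b :: "real ^ 'n \<Rightarrow> real ^ 'n \<Rightarrow> real"
  assumes "bilinear b" "\<And>v. (\<And>u. b u v = 0) \<Longrightarrow> v = 0"
  shows "invertible (\<chi> i j. b (axis i 1) (axis j 1))" (is "invertible ?M")
proof -
  have "v = 0" if "?M *v v = 0" for v
    using assms(2)[of v] bilinear_gram_matrix[OF assms(1), of _ v] that by simp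
  then show ?thesis
    by (simp add: invertible_left_inverse matrix_left_invertible_ker)
qed

text \<open>Taking adjoints with respect to a nondegenerate form conjugates the transpose by the Gram
  matrix of the form.\<close>

lemma tr_adjoint:
  fixes f h :: "real ^ 'n \<Rightarrow> real ^ 'n" and b :: "real ^ 'n \<Rightarrow> real ^ 'n \<Rightarrow> real"
  assumes b: "bilinear b" "\<And>v. (\<And>u. b u v = 0) \<Longrightarrow> v = 0"
    and f: "linear f" and h: "linear h" and adj: "\<And>u v. b (f u) v = b u (h v)"
  shows "tr f = tr h"
proof -
  let ?M = "(\<chi> i j. b (axis i 1) (axis j 1)) :: real ^ 'n ^ 'n"
  have "u \<bullet> ((transpose (matrix f) ** ?M) *v v) = u \<bullet> ((?M ** matrix h) *v v)" for u v
  proof -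
    have "b (f u) v = (matrix f *v u) \<bullet> (?M *v v)"
      using bilinear_gram_matrix[OF b(1), of "f u" v] f by simp
    also have "\<dots> = u \<bullet> ((transpose (matrix f) ** ?M) *v v)"
      using dot_lmul_matrix[of u "transpose (matrix f)" "?M *v v"]
      by (simp only: vector_transpose_matrix matrix_vector_mul_assoc)
    finally have "b (f u) v = \<dots>" .
    moreover have "b u (h v) = u \<bullet> ((?M ** matrix h) *v v)"
      using bilinear_gram_matrix[OF b(1), of u "h v"] h by (simp add: matrix_vector_mul_assoc[symmetric])
    ultimately show ?thesis using adj by simp
  qed
  then have "(transpose (matrix f) ** ?M) *v v = (?M ** matrix h) *v v" for v
    by (rule vector_eq_ldot[THEN iffD1, rule_format])
  then have eq: "transpose (matrix f) ** ?M = ?M ** matrix h"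
    by (intro matrix_eq[THEN iffD2] allI)
  obtain M' where M': "?M ** M' = mat 1" "M' ** ?M = mat 1"
    using invertible_gram_matrix[OF b] unfolding invertible_def by blast
  have "tr h = trace (M' ** (?M ** matrix h))"
    by (simp add: matrix_mul_assoc M')
  also have "\<dots> = trace (transpose (matrix f) ** ?M ** M')"
    unfolding eq[symmetric] by (rule trace_mul_sym)
  also have "\<dots> = trace (transpose (matrix f))"
    by (simp add: matrix_mul_assoc[symmetric] M')
  finally show ?thesis by (simp add: trace_def transpose_def)
qed

section \<open>The algebra of a nearly pseudo-Kaehler structure at a point\<close>

text \<open>\<open>A u v\<close> stands for \<open>(\<nabla>\<^sub>u J) v\<close>.\<close>

locale nk_point =
  fixes g :: "real ^ 'n \<Rightarrow> real ^ 'n \<Rightarrow> real" and J :: "real ^ 'n \<Rightarrow> real ^ 'n::finite"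
    and A :: "real ^ 'n \<Rightarrow> real ^ 'n \<Rightarrow> real ^ 'n"
  assumes g_bilinear: "bilinear g" and g_sym: "g u v = g v u"
    and g_nondegenerate: "(\<And>v. g u v = 0) \<Longrightarrow> u = 0"
    and J_linear: "linear J" and JJ [simp]: "J (J u) = - u" and g_J_J [simp]: "g (J u) (J v) = g u v"
    and A_bilinear: "bilinear A" and A_same [simp]: "A u u = 0"
    and A_skew: "g (A u v) w = - g v (A u w)" and A_J: "A u (J v) = - J (A u v)"
begin

lemmas g_simps [simp] = bilinear_ladd[OF g_bilinear] bilinear_radd[OF g_bilinear]
  bilinear_lsub[OF g_bilinear] bilinear_rsub[OF g_bilinear] bilinear_lneg[OF g_bilinear]
  bilinear_rneg[OF g_bilinear] bilinear_lmul[OF g_bilinear] bilinear_rmul[OF g_bilinear]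
  bilinear_lzero[OF g_bilinear] bilinear_rzero[OF g_bilinear]

lemmas A_simps [simp] = bilinear_ladd[OF A_bilinear] bilinear_radd[OF A_bilinear]
  bilinear_lsub[OF A_bilinear] bilinear_rsub[OF A_bilinear] bilinear_lneg[OF A_bilinear]
  bilinear_rneg[OF A_bilinear] bilinear_lmul[OF A_bilinear] bilinear_rmul[OF A_bilinear]
  bilinear_lzero[OF A_bilinear] bilinear_rzero[OF A_bilinear]

lemmas J_simps [simp] = linear_add[OF J_linear] linear_diff[OF J_linear] linear_neg[OF J_linear]
  linear_cmul[OF J_linear] linear_0[OF J_linear]

lemma A_linear: "linear (A u)" "linear (\<lambda>v. A v u)"
  using A_bilinear by (simp_all add: bilinear_def)

lemma g_linear: "linear (g u)" "linear (\<lambda>v. g v u)"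
  using g_bilinear by (simp_all add: bilinear_def)

lemma g_eqI: "(\<And>w. g u w = g v w) \<Longrightarrow> u = v"
  using g_nondegenerate[of "u - v"] by simp

lemma g_nondegenerate': "(\<And>u. g u v = 0) \<Longrightarrow> v = 0"
  using g_nondegenerate g_sym by metis

lemma g_J: "g (J u) v = - g u (J v)"
  using g_J_J[of u "J v"] by simp

lemma A_swap: "A u v = - A v u"
  using A_same[of "u + v"] by (simp del: A_same add: A_same[of u] A_same[of v] add_eq_0_iff)

lemma A_J_left: "A (J u) v = - J (A u v)"
  using A_swap[of "J u" v] A_J[of v u] A_swap[of u v] by simp

end

text \<open>The jet adds the covariant derivative \<open>B\<close> of \<open>A\<close>, where \<open>B w x y = (\<nabla>\<^sub>w A) x y\<close>, and the
  curvature \<open>R\<close>; its assumptions are the derivatives of those on \<open>A\<close>, the Ricci identity for \<open>J\<close>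
  and the symmetries of a curvature tensor.\<close>

locale nk_jet = nk_point g J A
  for g :: "real ^ 'n \<Rightarrow> real ^ 'n \<Rightarrow> real" and J :: "real ^ 'n \<Rightarrow> real ^ 'n::finite"
    and A :: "real ^ 'n \<Rightarrow> real ^ 'n \<Rightarrow> real ^ 'n" +
  fixes B R :: "real ^ 'n \<Rightarrow> real ^ 'n \<Rightarrow> real ^ 'n \<Rightarrow> real ^ 'n"
  assumes B_swap: "B w x y = - B w y x"
    and B_skew: "g (B w x y) z = - g y (B w x z)"
    and B_J: "B w x (J y) + J (B w x y) = - (A x (A w y) + A w (A x y))"
    and ricci_identity: "B w x y - B x w y = R w x (J y) - J (R w x y)"
    and R_linear: "linear (R w x)"
    and R_swap: "R w x y = - R x w y"
    and R_skew: "g (R w x y) z = - g y (R w x z)"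
    and bianchi: "R w x y + R x y w + R y w x = 0"
begin

text \<open>Alternating the Ricci identity over its four arguments makes the curvature disappear, so
  \<open>B\<close> has no totally alternating part; with that, the cyclic sum of the Ricci identity determines
  \<open>B\<close> itself.\<close>

lemma B_from_curvature:
  "2 * g (B z w x) y = g (R w x (J y)) z + g (R x y (J w)) z + g (R y w (J x)) z"
proof -
  define b where "b w x y z = g (B w x y) z" for w x y z
  define r where "r w x y z = g (R w x y) z" for w x y z
  have b1: "b w x y z = - b w y x z" for w x y z
    unfolding b_def by (subst B_swap) simp
  have b2: "b w x y z = - b w x z y" for w x y z
    unfolding b_def using B_skew[of w x y z] g_sym[of y "B w x z"] by simp
  have r1: "r w x y z = - r x w y z" for w x y z
    unfolding r_def by (subst R_swap) simp
  have r2: "r w x y z = - r w x z y" for w x y z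
    unfolding r_def using R_skew[of w x y z] g_sym[of y "R w x z"] by simp
  have bia: "r w x y z + r x y w z + r y w x z = 0" for w x y z
    using arg_cong[OF bianchi[of w x y], of "\<lambda>v. g v z"] unfolding r_def by simp
  have ric: "b w x y z - b x w y z = r w x (J y) z + r w x y (J z)" for w x y z
    using arg_cong[OF ricci_identity[of w x y], of "\<lambda>v. g v z"] unfolding r_def b_def by (simp add: g_J)
  have b3: "b w x y z = b w y z x" for w x y z
    using b1[of w x y z] b2[of w y x z] by simp
  have ric': "b w x y z - b x w y z = r w x y (J z) - r w x z (J y)" for w x y z
    using ric[of w x y z] r2[of w x "J y" z] by simp
  have bia': "r w x y u + r x y w u - r w y x u = 0" for w x y u
    using bia[of w x y u] r1[of y w x u] by simp
  \<comment> \<open>The even permutations of the four arguments give six instances of the Ricci identity. Moving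
    \<open>J\<close> into the last slot groups their curvature terms into Bianchi sums.\<close>
  have alt: "b w x y z - b x w y z + b y w x z - b z w x y = 0"
  proof -
    have "b y w x z - b x w y z = r x y w (J z) - r x y z (J w)"
      using ric'[of x y w z] b1[of x y w z] b1[of y x w z] by linarith
    moreover have "b y w x z + b w x y z = r y w x (J z) - r y w z (J x)"
      using ric'[of y w x z] b1[of w y x z] by linarith
    moreover have "b y w x z - b z w x y = r y z w (J x) - r y z x (J w)"
      using ric'[of y z w x] b3[of y z w x] b3[of z y w x] by linarith
    moreover have "b w x y z - b z w x y = r w z x (J y) - r w z y (J x)"
      using ric'[of w z x y] b3[of w z x y] by linarith
    moreover have "- b x w y z - b z w x y = r x z y (J w) - r x z w (J y)"
      using ric'[of x z y w] b3[of x z y w] b1[of x y w z] b3[of z w x y] by linarith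
    moreover note ric'[of w x y z] bia[of w x y "J z"] bia'[of w x z "J y"] bia'[of x y z "J w"]
      bia'[of y w z "J x"]
    ultimately show ?thesis using r1[of w y x "J z"] by linarith
  qed
  have "2 * b z w x y = r w x (J y) z + r x y (J w) z + r y w (J x) z"
    using alt ric[of w x y z] ric[of x y w z] ric[of y w x z] bia[of w x y "J z"]
      b1[of w x y z] b1[of x w y z] b1[of y w x z] by linarith
  then show ?thesis by (simp add: b_def r_def)
qed

text \<open>Because of \<open>B_J\<close> it suffices to know the part of \<open>B z\<close> of type (3,0)+(0,3), and there the
  terms of \<open>B_from_curvature\<close> cancel by the Bianchi identity.\<close>

proposition B_eq:
  "B w x y = (1/2) *\<^sub>R (J (A w (A x y)) + J (A x (A w y)) - J (A y (A w x)))"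
proof (rule g_eqI)
  fix z
  have bia: "g (R w x y) u + g (R x y w) u + g (R y w x) u = 0" for w x y u
    using arg_cong[OF bianchi[of w x y], of "\<lambda>v. g v u"] by simp
  have Rn: "R w x (- y) = - R w x y" for w x y
    by (rule linear_neg[OF R_linear])
  \<comment> \<open>Four times the part of type (3,0)+(0,3): by \<open>B_from_curvature\<close> each choice of the arguments
    carrying \<open>J\<close> contributes a Bianchi sum.\<close>
  have pure: "g (B w x y) z - g (B w (J x) (J y)) z - g (B w (J x) y) (J z) - g (B w x (J y)) (J z) = 0"
    using B_from_curvature[of w x y z] B_from_curvature[of w "J x" "J y" z]
      B_from_curvature[of w "J x" y "J z"] B_from_curvature[of w x "J y" "J z"]
      bia[of "J x" y z w] bia[of x "J y" z w] bia[of x y "J z" w] bia[of "J x" "J y" "J z" w]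
    by (simp add: Rn)
  have B_skew': "g (B w x y) z = - g (B w x z) y" for x y z
    using B_skew[of w x y z] g_sym[of y "B w x z"] by simp
  have gB_swap: "g (B w x y) z = - g (B w y x) z" for x y z
    by (subst B_swap) simp
  \<comment> \<open>Two \<open>J\<close>s are removed at the cost of a quadratic term, so \<open>pure\<close> becomes an equation for
    \<open>B\<close> itself.\<close>
  have JJ_slot: "g (B w x (J y)) (J z) = - g (B w x y) z - g (A x (A w y) + A w (A x y)) (J z)" for x y z
  proof -
    have "B w x (J y) = - (A x (A w y) + A w (A x y)) - J (B w x y)"
      by (simp only: eq_diff_eq B_J)
    then show ?thesis by simp
  qed
  have "g (B w (J x) (J y)) z = g (B w z (J x)) (J y)"
    using gB_swap[of z "J x" "J y"] B_skew'[of "J x" z "J y"] by simp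
  moreover have "g (B w (J x) y) (J z) = g (B w y (J z)) (J x)"
    using gB_swap[of "J x" y "J z"] B_skew'[of y "J x" "J z"] by simp
  moreover have "g (B w z x) y = g (B w x y) z" "g (B w y z) x = g (B w x y) z"
    using gB_swap[of z x y] B_skew'[of x z y] gB_swap[of x y z] B_skew'[of y x z] by simp_all
  ultimately have four: "4 * g (B w x y) z =
      - g (A z (A w x) + A w (A z x)) (J y) - g (A y (A w z) + A w (A y z)) (J x)
      - g (A x (A w y) + A w (A x y)) (J z)"
    using pure JJ_slot[of z x y] JJ_slot[of y z x] JJ_slot[of x y z] by simp
  \<comment> \<open>All quadratic terms are values of one form, alternating in its last two arguments.\<close>
  define p where "p x y z = g (A w x) (J (A y z))" for x y z
  have p_swap: "p x y z = - p x z y" for x y z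
    unfolding p_def by (subst A_swap) simp
  have 1: "g (A z (A w x)) (J y) = - p x y z" for x y z
    unfolding p_def using A_skew[of z "A w x" "J y"] A_swap[of y z] by (simp add: A_J)
  have 2: "g (A w (A z x)) (J y) = - p y z x" for x y z
    unfolding p_def using A_skew[of w "A z x" "J y"] g_J[of "A z x" "A w y"] g_sym[of "J (A z x)" "A w y"]
    by (simp add: A_J)
  have 3: "g (J (A w (A x y))) z = p z x y" for x y z
    using 2[of x y z] g_J[of "A w (A x y)" z] by simp
  have 4: "g (J (A x (A w y))) z = p y z x" for x y z
    using 1[of x y z] g_J[of "A x (A w y)" z] by simp
  show "g (B w x y) z = g ((1/2) *\<^sub>R (J (A w (A x y)) + J (A x (A w y)) - J (A y (A w x)))) z"
  proof -
    have "4 * g (B w x y) z = 2 * (p z x y - p y x z + p x y z)"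
      using four p_swap[of z y x] p_swap[of y z x] p_swap[of x z y] by (simp add: 1 2)
    moreover have "g (J (A y (A w x))) z = p x z y" using 4[of y x z] by simp
    ultimately show ?thesis
      using p_swap[of y x z] p_swap[of x z y] by (simp add: 3 4)
  qed
qed

end

section \<open>Constant type\<close>

locale nk_constant_type = nk_point g J A
  for g :: "real ^ 'n \<Rightarrow> real ^ 'n \<Rightarrow> real" and J :: "real ^ 'n \<Rightarrow> real ^ 'n::finite"
    and A :: "real ^ 'n \<Rightarrow> real ^ 'n \<Rightarrow> real ^ 'n" +
  fixes \<alpha> :: real
  assumes constant_type: "g (A u v) (A u v) = \<alpha> * (g u u * g v v - (g u v)\<^sup>2 - (g (J u) v)\<^sup>2)"
begin

lemma constant_type_polarized:
  "g (A u v) (A u w) = \<alpha> * (g u u * g v w - g u v * g u w - g (J u) v * g (J u) w)"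
proof -
  have "2 * g (A u v) (A u w) = g (A u (v + w)) (A u (v + w)) - g (A u v) (A u v) - g (A u w) (A u w)"
    by (simp add: g_sym[of "A u w" "A u v"])
  also have "\<dots> = 2 * (\<alpha> * (g u u * g v w - g u v * g u w - g (J u) v * g (J u) w))"
    unfolding constant_type by (simp add: g_sym[of w v] power2_eq_square algebra_simps)
  finally show ?thesis by simp
qed

lemma A_square: "A u (A u v) = - \<alpha> *\<^sub>R (g u u *\<^sub>R v - g u v *\<^sub>R u - g (J u) v *\<^sub>R J u)"
proof (rule g_eqI)
  fix w
  have "g (A u (A u v)) w = - g (A u v) (A u w)" by (rule A_skew)
  then show "g (A u (A u v)) w = g (- \<alpha> *\<^sub>R (g u u *\<^sub>R v - g u v *\<^sub>R u - g (J u) v *\<^sub>R J u)) w"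
    by (simp add: constant_type_polarized algebra_simps)
qed

lemma tr_A_A:
  assumes "CARD('n) = 6"
  shows "tr (\<lambda>y. A u (A v y)) = - 4 * \<alpha> * g u v"
proof -
  have sq: "tr (\<lambda>y. A u (A u y)) = - 4 * \<alpha> * g u u" for u
  proof -
    have "tr (\<lambda>y. A u (A u y)) = - \<alpha> * (g u u * 6 - g u u - g (J u) (J u))"
      unfolding A_square tr_scaleR tr_diff tr_id tr_rank_one[OF g_linear(1)] assms by simp
    then show ?thesis by simp
  qed
  have "tr (\<lambda>y. A (u + v) (A (u + v) y)) =
      tr (\<lambda>y. A u (A u y)) + tr (\<lambda>y. A v (A v y)) + (tr (\<lambda>y. A u (A v y)) + tr (\<lambda>y. A v (A u y)))"
    by (simp add: tr_add)
  then show ?thesis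
    unfolding sq using tr_comp_commute[OF A_linear(1)[of u] A_linear(1)[of v]] g_sym[of v u]
    by (simp add: algebra_simps)
qed

text \<open>If \<open>\<alpha> = 0\<close>, then \<open>A u (A v w)\<close> is alternating in all three arguments. Replacing \<open>u\<close> by \<open>J u\<close>
  multiplies it by \<open>- J\<close>, but after a cyclic permutation \<open>u\<close> is the innermost argument and the
  factor is \<open>J\<close>. So it vanishes, and every vector in the image of \<open>A\<close> contradicts strictness.\<close>

lemma constant_type_nonzero:
  fixes u :: "real ^ 'n"
  assumes strict: "\<And>u. u \<noteq> 0 \<Longrightarrow> \<exists>v. A u v \<noteq> 0" and u: "u \<noteq> 0"
  shows "\<alpha> \<noteq> 0"
proof
  assume "\<alpha> = 0"
  then have sq: "A u (A u v) = 0" for u v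
    by (simp add: A_square)
  have swap12: "A u (A v w) = - A v (A u w)" for u v w
    using sq[of "u + v" w] by (simp add: sq add_eq_0_iff)
  have swap23: "A u (A v w) = - A u (A w v)" for u v w
    by (subst A_swap[of v w]) simp
  have cyc: "A u (A v w) = A v (A w u)" for u v w
    using swap12[of u v w] swap23[of v u w] by simp
  have "A (J u) (A v w) = - J (A u (A v w))" for u v w
    by (rule A_J_left)
  moreover have "A (J u) (A v w) = J (A u (A v w))" for u v w
    using cyc[of "J u" v w] cyc[of u v w] by (simp add: A_J)
  ultimately have "J (A u (A v w)) = - J (A u (A v w))" for u v w
    by metis
  then have "J (A u (A v w)) = 0" for u v w
    by (simp add: eq_neg_iff_add_eq_0 flip: scaleR_2)
  then have "J (J (A u (A v w))) = 0" for u v w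
    by (simp only: J_simps)
  then have zero: "A u (A v w) = 0" for u v w
    by simp
  obtain v where "A u v \<noteq> 0" using strict[OF u] by blast
  then obtain w where "A (A u v) w \<noteq> 0" using strict by blast
  moreover have "A (A u v) w = 0" using A_swap[of "A u v" w] zero by simp
  ultimately show False by simp
qed

text \<open>On a complex volume form a complex-linear endomorphism acts by its complex trace, and \<open>A\<close> is the real part of
  one. To see this through constant type, note that \<open>ann\<close> says \<open>A (T u) = [T, A u]\<close>; hence
  \<open>tr (A (T u) \<circ> A (J u))\<close> is the trace of \<open>T \<circ> [A u, A (J u)]\<close>, and the commutator is
  \<open>- 2 \<alpha> g u u J\<close> up to terms of rank one. The rank-one terms cancel against the left-hand side.\<close>

lemma tr_annihilator:
  assumes card: "CARD('n) = 6" and \<alpha>: "\<alpha> \<noteq> 0" and T: "linear T"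
    and skew: "\<And>u v. g (T u) v = - g u (T v)"
    and ann: "\<And>u v. T (A u v) = A (T u) v + A u (T v)"
  shows "tr (\<lambda>y. T (J y)) = 0"
proof -
  \<comment> \<open>The form may be indefinite, so a vector that is not null has to be chosen.\<close>
  have "\<exists>u. g u u \<noteq> 0"
  proof (rule ccontr)
    assume "\<not> (\<exists>u. g u u \<noteq> 0)"
    then have null: "g u u = 0" for u by blast
    have "g u v = 0" for u v
    proof -
      have "g u v + g v u = 0" using null[of "u + v"] by (simp add: null[of u] null[of v])
      then show ?thesis using g_sym[of v u] by linarith
    qed
    then have "axis i 1 = (0 :: real ^ 'n)" for i
      by (intro g_nondegenerate)
    then show False
      by (simp add: axis_eq_0_iff)
  qed
  then obtain u where u: "g u u \<noteq> 0" by blast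
  note T_simps = linear_add[OF T] linear_diff[OF T] linear_neg[OF T] linear_cmul[OF T] linear_0[OF T]
  have comm: "A u (A (J u) y) - A (J u) (A u y) =
      (- 2 * \<alpha>) *\<^sub>R (g u u *\<^sub>R J y - g u y *\<^sub>R J u + g (J u) y *\<^sub>R u)" for y
  proof -
    have "A u (A (J u) y) - A (J u) (A u y) = 2 *\<^sub>R J (A u (A u y))"
      by (simp add: A_J_left A_J scaleR_2)
    also have "\<dots> = (- 2 * \<alpha>) *\<^sub>R (g u u *\<^sub>R J y - g u y *\<^sub>R J u + g (J u) y *\<^sub>R u)"
      unfolding A_square by (simp add: algebra_simps)
    finally show ?thesis .
  qed
  have lin: "linear (\<lambda>y. T (A u y))" "linear (\<lambda>y. A u (T y))" "linear (A u)" "linear (A (J u))"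
    using linear_compose[OF A_linear(1)[of u] T] linear_compose[OF T A_linear(1)[of u]] A_linear(1)
    by (simp_all add: o_def)
  have "- 4 * \<alpha> * g (T u) (J u) = tr (\<lambda>y. A (T u) (A (J u) y))"
    by (rule tr_A_A[OF card, symmetric])
  also have "\<dots> = tr (\<lambda>y. T (A u (A (J u) y)) - A u (T (A (J u) y)))"
    by (rule arg_cong[of _ _ tr]) (simp add: fun_eq_iff ann)
  also have "\<dots> = tr (\<lambda>y. T (A u (A (J u) y))) - tr (\<lambda>y. A (J u) (A u (T y)))"
    unfolding tr_diff using tr_comp_commute[OF lin(2,4)] by simp
  also have "\<dots> = tr (\<lambda>y. T (A u (A (J u) y))) - tr (\<lambda>y. T (A (J u) (A u y)))"
  proof -
    have "linear (\<lambda>y. A (J u) (A u y))"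
      using linear_compose[OF lin(3,4)] by (simp add: o_def)
    then show ?thesis using tr_comp_commute[OF T] by simp
  qed
  also have "\<dots> = tr (\<lambda>y. (- 2 * \<alpha>) *\<^sub>R (g u u *\<^sub>R T (J y) - g u y *\<^sub>R T (J u) + g (J u) y *\<^sub>R T u))"
    unfolding tr_diff[symmetric] T_simps(2)[symmetric] comm by (simp add: T_simps)
  also have "\<dots> = - 2 * \<alpha> * (g u u * tr (\<lambda>y. T (J y)) - g u (T (J u)) + g (J u) (T u))"
    unfolding tr_scaleR tr_diff tr_add tr_rank_one[OF g_linear(1)] ..
  also have "\<dots> = - 2 * \<alpha> * (g u u * tr (\<lambda>y. T (J y)) + 2 * g (T u) (J u))"
    using skew[of u "J u"] g_sym[of "J u" "T u"] by simp
  finally show ?thesis using u \<alpha> by simp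
qed

end

section \<open>The Einstein condition at a point\<close>

text \<open>\<open>N u w\<close> is the curvature of the canonical Hermitian connection \<open>\<nabla> - (1/2) J (\<nabla>J)\<close>, expressed
  by the Levi-Civita curvature.\<close>

locale nk_curvature = nk_jet g J A B R + nk_constant_type g J A \<alpha>
  for g :: "real ^ 'n \<Rightarrow> real ^ 'n \<Rightarrow> real" and J :: "real ^ 'n \<Rightarrow> real ^ 'n::finite"
    and A :: "real ^ 'n \<Rightarrow> real ^ 'n \<Rightarrow> real ^ 'n"
    and B R :: "real ^ 'n \<Rightarrow> real ^ 'n \<Rightarrow> real ^ 'n \<Rightarrow> real ^ 'n" and \<alpha> :: real +
  fixes N :: "real ^ 'n \<Rightarrow> real ^ 'n \<Rightarrow> real ^ 'n \<Rightarrow> real ^ 'n"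
  assumes N_eq: "N u w y = R u w y - (1/4) *\<^sub>R (A u (A w y) - A w (A u y)) + (1/2) *\<^sub>R A (A u w) y"
    and N_annihilates: "N u w (A x y) = A (N u w x) y + A x (N u w y)"
    and card: "CARD('n) = 6" and strict: "u \<noteq> 0 \<Longrightarrow> \<exists>v. A u v \<noteq> 0"
begin

lemma alpha_nonzero: "\<alpha> \<noteq> 0"
proof -
  have "axis i 1 \<noteq> (0 :: real ^ 'n)" for i by (simp add: axis_eq_0_iff)
  then show ?thesis using constant_type_nonzero[OF strict] by blast
qed

lemma R_J: "R w x (J y) = J (R w x y) - J (A y (A w x))"
proof -
  have "B w x y - B x w y = - J (A y (A w x))"
    unfolding B_eq A_swap[of x w] by (simp add: scaleR_right_diff_distrib[symmetric] scaleR_right_distrib[symmetric])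
  then show ?thesis using ricci_identity[of w x y] by (simp add: algebra_simps)
qed

lemma tr_J_A_A: "tr (\<lambda>y. J (A u (A w y))) = 4 * \<alpha> * g (J u) w"
  using tr_A_A[OF card, of "J u" w] by (simp add: A_J_left tr_minus)

lemma tr_J_A: "tr (\<lambda>y. J (A u y)) = 0"
  using tr_comp_commute[OF J_linear A_linear(1)[of u]] by (simp add: A_J tr_minus)

text \<open>The complex trace of \<open>N u w\<close> vanishes because \<open>N u w\<close> annihilates \<open>A\<close>; the remaining terms of
  \<open>N_eq\<close> are traces of products of two values of \<open>A\<close>.\<close>

lemma tr_J_R: "tr (\<lambda>y. J (R u w y)) = 2 * \<alpha> * g (J u) w"
proof -
  have N_lin: "linear (N u w)"
    unfolding N_eq[abs_def]
    by (intro linear_compose_add linear_compose_sub linear_compose_scale_right R_linear A_linear(1)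
          linear_compose[OF A_linear(1) A_linear(1), unfolded o_def])
  have N_skew: "g (N u w x) y = - g x (N u w y)" for x y
    unfolding N_eq using R_skew[of u w x y] by (simp add: A_skew algebra_simps)
  have "0 = tr (\<lambda>y. N u w (J y))"
    by (rule tr_annihilator[OF card alpha_nonzero N_lin N_skew N_annihilates, symmetric])
  also have "\<dots> = tr (\<lambda>y. J (N u w y))"
    by (rule tr_comp_commute[OF N_lin J_linear])
  also have "\<dots> = tr (\<lambda>y. J (R u w y)) - 1/4 * (4 * \<alpha> * g (J u) w - 4 * \<alpha> * g (J w) u)"
    unfolding N_eq J_simps tr_add tr_diff tr_scaleR tr_J_A_A tr_J_A by simp
  finally show ?thesis
    using g_J[of w u] g_sym[of w "J u"] by simp
qed

lemma R_pair: "g (R u v w) x = g (R w x u) v"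
proof -
  define r where "r w x y z = g (R w x y) z" for w x y z
  have r1: "r w x y z = - r x w y z" for w x y z
    unfolding r_def by (subst R_swap) simp
  have r2: "r w x y z = - r w x z y" for w x y z
    unfolding r_def using R_skew[of w x y z] g_sym[of y "R w x z"] by simp
  have bia: "r w x y z + r x y w z + r y w x z = 0" for w x y z
    using arg_cong[OF bianchi[of w x y], of "\<lambda>v. g v z"] unfolding r_def by simp
  have "r u v w x = r w x u v"
    using bia[of u v w x] bia[of v w x u] bia[of w x u v] bia[of x u v w]
      r1[of w u v x] r2[of u w v x] r2[of v w x u] r1[of x v w u] r2[of v x w u] r1[of w x v u] r2[of w x v u]
      r1[of u w x v] r2[of u w x v] r2[of x u v w] r1[of x u w v] r2[of u x w v] r1[of u v x w] r2[of u v x w]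
      r2[of v w u x] r1[of v x u w] r2[of x v w u] r2[of x u w v]
    by linarith
  then show ?thesis by (simp add: r_def)
qed

text \<open>Pair symmetry moves the first argument to the third one, in which \<open>R\<close> is linear.\<close>

lemma R_linear_left: "linear (\<lambda>y. R y u w)"
proof (rule linearI)
  have R': "g (R y u w) v = g (R w v y) u" for y v by (rule R_pair)
  show "R (y + z) u w = R y u w + R z u w" for y z
    by (rule g_eqI) (simp add: R' linear_add[OF R_linear])
  show "R (c *\<^sub>R y) u w = c *\<^sub>R R y u w" for c y
    by (rule g_eqI) (simp add: R' linear_cmul[OF R_linear])
qed

text \<open>By pair symmetry the left-hand side is skew in \<open>u\<close> and \<open>w\<close>, and by the Bianchi identity
  twice its value is the trace of \<open>R w u \<circ> J\<close>.\<close>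

lemma tr_J_R_left: "tr (\<lambda>y. J (R y u w)) = \<alpha> * g (J w) u"
proof -
  have lin: "linear (\<lambda>y. R (J y) u w)" "linear (\<lambda>y. J (R y u w))" for u w
    using linear_compose[OF J_linear R_linear_left] linear_compose[OF R_linear_left J_linear]
    by (simp_all add: o_def)
  have comm: "tr (\<lambda>y. R (J y) u w) = tr (\<lambda>y. J (R y u w))" for u w
    by (rule tr_comp_commute[OF R_linear_left J_linear])
  have "g (R (J y) u w) z = g y (- J (R z w u))" for y z
    using R_pair[of "J y" u w z] R_skew[of w z "J y" u] R_swap[of w z u] g_J[of y "R z w u"] by simp
  then have "tr (\<lambda>y. R (J y) u w) = tr (\<lambda>z. - J (R z w u))"
    by (intro tr_adjoint[OF g_bilinear g_nondegenerate' lin(1)] linear_compose_neg lin(2))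
  then have skew: "tr (\<lambda>y. J (R y u w)) = - tr (\<lambda>y. J (R y w u))"
    by (simp add: comm tr_minus)
  have "R w u (J y) = R (J y) u w - R (J y) w u" for y
    using bianchi[of w u "J y"] R_swap[of u "J y" w] by (simp add: algebra_simps add_eq_0_iff)
  then have "tr (\<lambda>y. R w u (J y)) = tr (\<lambda>y. J (R y u w)) - tr (\<lambda>y. J (R y w u))"
    by (simp add: tr_diff comm)
  moreover have "tr (\<lambda>y. R w u (J y)) = 2 * \<alpha> * g (J w) u"
    using tr_comp_commute[OF R_linear J_linear] tr_J_R by simp
  ultimately show ?thesis using skew by simp
qed

text \<open>\<open>R_J\<close> takes \<open>J\<close> out of \<open>R y u (J v)\<close>. The *-Ricci tensor contributes \<open>\<alpha>\<close> and the quadratic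
  correction \<open>4 \<alpha>\<close>.\<close>

theorem einstein_at_point: "tr (\<lambda>y. R y u w) = 5 * \<alpha> * g u w"
proof -
  have "tr (\<lambda>y. R y u (J v)) = 5 * \<alpha> * g (J v) u" for v
  proof -
    have "R y u (J v) = J (R y u v) + J (A v (A u y))" for y
      using R_J[of y u v] A_swap[of y u] by simp
    then show ?thesis
      by (simp add: tr_add tr_J_R_left tr_J_A_A)
  qed
  from this[of "- J w"] show ?thesis by (simp add: g_sym[of w u])
qed

end

section \<open>Fields of endomorphisms\<close>

text \<open>Smoothness is only required on constant arguments, since by linearity it then holds along every
  smooth argument.\<close>

definition operator_field :: "(real ^ 'n) set \<Rightarrow> (real ^ 'n \<Rightarrow> real ^ 'n \<Rightarrow> real ^ 'n::finite) \<Rightarrow> bool" where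
  "operator_field S K \<longleftrightarrow> (\<forall>p\<in>S. linear (K p)) \<and> (\<forall>v. smooth_on S (\<lambda>p. K p v))"

lemma smooth_on_operator_field:
  assumes S: "open S" and K: "operator_field S K" and Y: "smooth_on S Y"
  shows "smooth_on S (\<lambda>p. K p (Y p))"
proof -
  have "smooth_on S (\<lambda>p. \<Sum>i\<in>UNIV. Y p $ i *\<^sub>R K p (axis i 1))"
    using K by (intro smooth_on_sum[OF S] smooth_on_scaleR[OF S] smooth_on_bounded_linear[OF S bounded_linear_vec_nth Y])
      (simp add: operator_field_def)
  moreover have "K p (Y p) = (\<Sum>i\<in>UNIV. Y p $ i *\<^sub>R K p (axis i 1))" if "p \<in> S" for p
    using K that by (intro linear_axis_expansion) (simp add: operator_field_def)
  ultimately show ?thesis by (rule smooth_on_cong[OF S, THEN iffD2, rotated])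
qed

lemma frechet_derivative_cong_on:
  assumes "open S" "p \<in> S" "smooth_on S f" "\<And>q. q \<in> S \<Longrightarrow> f q = h q"
  shows "frechet_derivative f (at p) u = frechet_derivative h (at p) u"
  by (rule fun_cong[OF frechet_derivative_transform_within_open[OF smooth_on_differentiable[OF assms(3,2)] assms(1,2,4)]])

lemma frechet_derivative_operator_field:
  assumes S: "open S" "p \<in> S" and K: "operator_field S K" and Y: "smooth_on S Y"
  shows "frechet_derivative (\<lambda>q. K q (Y q)) (at p) u =
    frechet_derivative (\<lambda>q. K q (Y p)) (at p) u + K p (frechet_derivative Y (at p) u)"
proof -
  let ?DK = "\<lambda>i. frechet_derivative (\<lambda>q. K q (axis i 1)) (at p)"
  have K': "smooth_on S (\<lambda>q. K q v)" "q \<in> S \<Longrightarrow> linear (K q)" for v q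
    using K by (simp_all add: operator_field_def)
  have hY: "((\<lambda>q. Y q $ i) has_derivative (\<lambda>h. frechet_derivative Y (at p) h $ i)) (at p)" for i
    by (rule bounded_linear.has_derivative[OF bounded_linear_vec_nth
          smooth_on_differentiable[OF Y S(2), unfolded frechet_derivative_works]])
  have hK: "((\<lambda>q. K q (axis i 1)) has_derivative ?DK i) (at p)" for i
    by (rule smooth_on_differentiable[OF K'(1) S(2), unfolded frechet_derivative_works])
  have "((\<lambda>q. \<Sum>i\<in>UNIV. Y q $ i *\<^sub>R K q (axis i 1)) has_derivative
     (\<lambda>h. \<Sum>i\<in>UNIV. Y p $ i *\<^sub>R ?DK i h + frechet_derivative Y (at p) h $ i *\<^sub>R K p (axis i 1))) (at p)"
    by (intro has_derivative_sum has_derivative_scaleR hY hK)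
  then have "((\<lambda>q. K q (Y q)) has_derivative
     (\<lambda>h. \<Sum>i\<in>UNIV. Y p $ i *\<^sub>R ?DK i h + frechet_derivative Y (at p) h $ i *\<^sub>R K p (axis i 1))) (at p)"
    by (rule has_derivative_transform_within_open[OF _ S]) (rule linear_axis_expansion[OF K'(2), symmetric])
  note 1 = frechet_derivative_at[OF this]
  have "((\<lambda>q. \<Sum>i\<in>UNIV. Y p $ i *\<^sub>R K q (axis i 1)) has_derivative
     (\<lambda>h. \<Sum>i\<in>UNIV. Y p $ i *\<^sub>R ?DK i h)) (at p)"
    by (intro has_derivative_sum has_derivative_scaleR_right hK)
  then have "((\<lambda>q. K q (Y p)) has_derivative (\<lambda>h. \<Sum>i\<in>UNIV. Y p $ i *\<^sub>R ?DK i h)) (at p)"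
    by (rule has_derivative_transform_within_open[OF _ S]) (rule linear_axis_expansion[OF K'(2), symmetric])
  note 2 = frechet_derivative_at[OF this]
  show ?thesis
    unfolding 1[symmetric] 2[symmetric]
    by (simp add: sum.distrib linear_axis_expansion[OF K'(2)[OF S(2)], symmetric])
qed

lemma linear_frechet_derivative_operator_field:
  assumes S: "open S" "p \<in> S" and K: "operator_field S K"
  shows "linear (\<lambda>v. frechet_derivative (\<lambda>q. K q v) (at p) u)"
proof -
  have K': "smooth_on S (\<lambda>q. K q v)" "q \<in> S \<Longrightarrow> linear (K q)" for v q
    using K by (simp_all add: operator_field_def)
  note h = smooth_on_differentiable[OF K'(1) S(2), unfolded frechet_derivative_works]
  show ?thesis
  proof (rule linearI)
    fix v w
    have "((\<lambda>q. K q (v + w)) has_derivative (\<lambda>h. frechet_derivative (\<lambda>q. K q v) (at p) h +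
        frechet_derivative (\<lambda>q. K q w) (at p) h)) (at p)"
      by (rule has_derivative_transform_within_open[OF has_derivative_add[OF h h] S]) (simp add: linear_add[OF K'(2)])
    from frechet_derivative_at[OF this, symmetric]
    show "frechet_derivative (\<lambda>q. K q (v + w)) (at p) u =
      frechet_derivative (\<lambda>q. K q v) (at p) u + frechet_derivative (\<lambda>q. K q w) (at p) u" by simp
  next
    fix c v
    have "((\<lambda>q. K q (c *\<^sub>R v)) has_derivative (\<lambda>h. c *\<^sub>R frechet_derivative (\<lambda>q. K q v) (at p) h)) (at p)"
      by (rule has_derivative_transform_within_open[OF has_derivative_scaleR_right[OF h] S]) (simp add: linear_cmul[OF K'(2)])
    from frechet_derivative_at[OF this, symmetric]
    show "frechet_derivative (\<lambda>q. K q (c *\<^sub>R v)) (at p) u = c *\<^sub>R frechet_derivative (\<lambda>q. K q v) (at p) u" by simp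
  qed
qed

lemma frechet_derivative_add_smooth:
  assumes "p \<in> S" "smooth_on S f" "smooth_on S h"
  shows "frechet_derivative (\<lambda>q. f q + h q) (at p) u = frechet_derivative f (at p) u + frechet_derivative h (at p) u"
  using frechet_derivative_at[OF has_derivative_add[OF
        smooth_on_differentiable[OF assms(2,1), unfolded frechet_derivative_works]
        smooth_on_differentiable[OF assms(3,1), unfolded frechet_derivative_works]], symmetric] by simp

lemma frechet_derivative_diff_smooth:
  assumes "p \<in> S" "smooth_on S f" "smooth_on S h"
  shows "frechet_derivative (\<lambda>q. f q - h q) (at p) u = frechet_derivative f (at p) u - frechet_derivative h (at p) u"
  using frechet_derivative_at[OF has_derivative_diff[OF
        smooth_on_differentiable[OF assms(2,1), unfolded frechet_derivative_works]
        smooth_on_differentiable[OF assms(3,1), unfolded frechet_derivative_works]], symmetric] by simp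

lemma frechet_derivative_minus_smooth:
  assumes "p \<in> S" "smooth_on S f"
  shows "frechet_derivative (\<lambda>q. - f q) (at p) u = - frechet_derivative f (at p) u"
  using frechet_derivative_at[OF has_derivative_minus[OF
        smooth_on_differentiable[OF assms(2,1), unfolded frechet_derivative_works]], symmetric] by simp

lemma frechet_derivative_scaleR_smooth:
  assumes "p \<in> S" "smooth_on S f"
  shows "frechet_derivative (\<lambda>q. c *\<^sub>R f q) (at p) u = c *\<^sub>R frechet_derivative f (at p) u"
  using frechet_derivative_at[OF has_derivative_scaleR_right[OF
        smooth_on_differentiable[OF assms(2,1), unfolded frechet_derivative_works]], symmetric] by simp

section \<open>Nearly pseudo-Kaehler structures in a coordinate domain\<close>

locale local_nearly_kaehler =
  fixes S :: "(real ^ 'n) set" and G :: "real ^ 'n \<Rightarrow> real ^ 'n \<Rightarrow> real ^ 'n::finite \<Rightarrow> real"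
    and J :: "real ^ 'n \<Rightarrow> real ^ 'n \<Rightarrow> real ^ 'n"
  assumes S: "open S"
    and G_bilinear: "p \<in> S \<Longrightarrow> bilinear (G p)" and G_sym: "p \<in> S \<Longrightarrow> G p u v = G p v u"
    and G_nondegenerate: "p \<in> S \<Longrightarrow> (\<And>v. G p u v = 0) \<Longrightarrow> u = 0"
    and G_smooth: "smooth_on S (\<lambda>p. G p u v)"
    and J_field: "operator_field S J" and JJ: "p \<in> S \<Longrightarrow> J p (J p u) = - u"
    and G_J_J: "p \<in> S \<Longrightarrow> G p (J p u) (J p v) = G p u v"
    and nearly_kaehler: "p \<in> S \<Longrightarrow> cov_deriv_endo G J (\<lambda>_. u) (\<lambda>_. u) p = 0"
begin

abbreviation D :: "real ^ 'n \<Rightarrow> (real ^ 'n \<Rightarrow> 'b::real_normed_vector) \<Rightarrow> real ^ 'n \<Rightarrow> 'b" where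
  "D u f p \<equiv> frechet_derivative f (at p) u"

text \<open>On fields that are constant in coordinates \<open>\<nabla>\<^sub>u v\<close> is \<open>Gam p u v\<close>. \<open>B\<close> and \<open>R\<close> are
  \<open>\<nabla>A\<close> and the curvature evaluated on such fields, whose brackets vanish.\<close>

definition Gam :: "real ^ 'n \<Rightarrow> real ^ 'n \<Rightarrow> real ^ 'n \<Rightarrow> real ^ 'n" where
  "Gam p u v = (\<chi> k. \<Sum>i\<in>UNIV. \<Sum>j\<in>UNIV. christoffel G k i j p * u $ i * v $ j)"

definition A :: "real ^ 'n \<Rightarrow> real ^ 'n \<Rightarrow> real ^ 'n \<Rightarrow> real ^ 'n" where
  "A p u v = cov_deriv_endo G J (\<lambda>_. u) (\<lambda>_. v) p"

definition B :: "real ^ 'n \<Rightarrow> real ^ 'n \<Rightarrow> real ^ 'n \<Rightarrow> real ^ 'n \<Rightarrow> real ^ 'n" where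
  "B p w x y = D w (\<lambda>q. A q x y) p + Gam p w (A p x y) - A p (Gam p w x) y - A p x (Gam p w y)"

definition R :: "real ^ 'n \<Rightarrow> real ^ 'n \<Rightarrow> real ^ 'n \<Rightarrow> real ^ 'n \<Rightarrow> real ^ 'n" where
  "R p w x y = D w (\<lambda>q. Gam q x y) p - D x (\<lambda>q. Gam q w y) p + Gam p w (Gam p x y) - Gam p x (Gam p w y)"

lemma gram_invertible: "p \<in> S \<Longrightarrow> invertible (gram G p)"
  unfolding gram_def
  by (rule invertible_gram_matrix[OF G_bilinear]) (auto intro: G_nondegenerate simp: G_sym)

lemma Gam_bilinear: "bilinear (Gam p)"
  unfolding bilinear_def Gam_def
  by (auto intro!: linearI simp: vec_eq_iff algebra_simps sum.distrib sum_distrib_left)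

lemma gram_smooth: "smooth_on S (\<lambda>p. gram G p $ i $ j)"
  using G_smooth by (simp add: gram_def)

lemma christoffel_smooth: "smooth_on S (christoffel G k i j)"
proof -
  have "smooth_on S (partial_deriv l (\<lambda>y. gram G y $ i $ j))" for l i j
    unfolding partial_deriv_def[abs_def] by (rule smooth_on_frechet_derivative[OF gram_smooth])
  then show ?thesis
    unfolding christoffel_def[abs_def]
    by (intro smooth_on_mult[OF S] smooth_on_const smooth_on_sum[OF S] smooth_on_add[OF S] smooth_on_diff[OF S]
        smooth_on_matrix_inv[OF S] gram_smooth gram_invertible)
qed

lemma Gam_smooth: "smooth_on S (\<lambda>p. Gam p u v)"
proof -
  have eq: "Gam p u v = (\<Sum>k\<in>UNIV. (\<Sum>i\<in>UNIV. \<Sum>j\<in>UNIV. christoffel G k i j p * u $ i * v $ j) *\<^sub>R axis k 1)" for p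
    using basis_expansion[of "Gam p u v"] by (simp add: Gam_def scalar_mult_eq_scaleR)
  show ?thesis
    unfolding eq by (intro smooth_on_sum[OF S] smooth_on_scaleR[OF S] smooth_on_const smooth_on_mult[OF S] christoffel_smooth)
qed

lemma Gam_field: "operator_field S (\<lambda>p. Gam p u)"
  using Gam_bilinear Gam_smooth by (simp add: operator_field_def bilinear_def)

lemma cov_deriv_eq: "cov_deriv G (\<lambda>_. u) Y p = D u Y p + Gam p u (Y p)"
  by (simp add: cov_deriv_def Gam_def)

lemma Gam_sym: "p \<in> S \<Longrightarrow> Gam p u v = Gam p v u"
  using cov_deriv_torsion_free[of S p G "\<lambda>_. u" "\<lambda>_. v", OF S _ G_sym]
  by (simp add: cov_deriv_eq lie_bracket_def)

lemma D_G:
  assumes "p \<in> S" "smooth_on S Y" "smooth_on S Z"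
  shows "D w (\<lambda>q. G q (Y q) (Z q)) p = G p (D w Y p + Gam p w (Y p)) (Z p) + G p (Y p) (D w Z p + Gam p w (Z p))"
  using cov_deriv_metric[of S p G Y Z "\<lambda>_. w", OF S assms(1) G_bilinear G_sym gram_invertible[OF assms(1)]
      smooth_on_differentiable[OF G_smooth assms(1)] smooth_on_differentiable[OF assms(2,1)]
      smooth_on_differentiable[OF assms(3,1)]]
  by (simp add: cov_deriv_eq)

lemma G_smooth_fields:
  assumes "smooth_on S Y" "smooth_on S Z"
  shows "smooth_on S (\<lambda>q. G q (Y q) (Z q))"
proof -
  have "smooth_on S (\<lambda>q. \<Sum>i\<in>UNIV. \<Sum>j\<in>UNIV. gram G q $ i $ j * Y q $ i * Z q $ j)"
    by (intro smooth_on_sum[OF S] smooth_on_mult[OF S] gram_smooth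
        smooth_on_bounded_linear[OF S bounded_linear_vec_nth assms(1)]
        smooth_on_bounded_linear[OF S bounded_linear_vec_nth assms(2)])
  then show ?thesis
    by (rule smooth_on_cong[OF S, THEN iffD2, rotated]) (rule bilinear_gram[of G, OF G_bilinear])
qed

lemma J_smooth: "smooth_on S (\<lambda>q. J q v)"
  using J_field by (simp add: operator_field_def)

lemma J_linear: "p \<in> S \<Longrightarrow> linear (J p)"
  using J_field by (simp add: operator_field_def)

lemma A_eq: "A p u v = D u (\<lambda>q. J q v) p + Gam p u (J p v) - J p (Gam p u v)"
  by (simp add: A_def cov_deriv_endo_def cov_deriv_eq)

lemma D_J: "D u (\<lambda>q. J q v) p = A p u v - Gam p u (J p v) + J p (Gam p u v)"
  by (simp add: A_eq)

lemmas Gam_simps = bilinear_ladd[OF Gam_bilinear] bilinear_radd[OF Gam_bilinear]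
  bilinear_lsub[OF Gam_bilinear] bilinear_rsub[OF Gam_bilinear] bilinear_lneg[OF Gam_bilinear]
  bilinear_rneg[OF Gam_bilinear] bilinear_lmul[OF Gam_bilinear] bilinear_rmul[OF Gam_bilinear]

lemma A_smooth: "smooth_on S (\<lambda>q. A q u v)"
  unfolding A_eq
  by (intro smooth_on_diff[OF S] smooth_on_add[OF S] smooth_on_frechet_derivative J_smooth
      smooth_on_operator_field[OF S Gam_field] smooth_on_operator_field[OF S J_field] Gam_smooth)

lemma A_bilinear:
  assumes p: "p \<in> S"
  shows "bilinear (A p)"
proof -
  note J_simps = linear_add[OF J_linear[OF p]] linear_cmul[OF J_linear[OF p]]
  note D_lin = linear_frechet_derivative_operator_field[OF S p J_field]
  note D_lin' = linear_frechet_derivative[OF smooth_on_differentiable[OF J_smooth p]]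
  show ?thesis
    unfolding bilinear_def A_eq
    by (auto intro!: linearI simp: Gam_simps J_simps linear_add[OF D_lin] linear_cmul[OF D_lin]
        linear_add[OF D_lin'] linear_cmul[OF D_lin'] algebra_simps)
qed

lemma A_field: "operator_field S (\<lambda>p. A p u)" "operator_field S (\<lambda>p v. A p v u)"
  using A_bilinear A_smooth by (auto simp: operator_field_def bilinear_def)

lemmas D_operator_field = frechet_derivative_operator_field[OF S]
lemmas D_cong_on = frechet_derivative_cong_on[OF S]

text \<open>Skewness of \<open>A\<close> and anticommutation with \<open>J\<close> are the derivatives of \<open>g (J v) w = - g v (J w)\<close>
  and of \<open>J (J v) = - v\<close>.\<close>

lemma nk_point:
  assumes p: "p \<in> S"
  shows "nk_point (G p) (J p) (A p)"
proof -
  note J_simps = linear_add[OF J_linear[OF p]] linear_diff[OF J_linear[OF p]] linear_neg[OF J_linear[OF p]]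
  note G_simps = bilinear_ladd[OF G_bilinear[OF p]] bilinear_radd[OF G_bilinear[OF p]]
    bilinear_lsub[OF G_bilinear[OF p]] bilinear_rsub[OF G_bilinear[OF p]]
    bilinear_lneg[OF G_bilinear[OF p]] bilinear_rneg[OF G_bilinear[OF p]]
  have G_J: "G q (J q u) v = - G q u (J q v)" if "q \<in> S" for q u v
    using G_J_J[OF that, of u "J q v"] JJ[OF that] bilinear_rneg[OF G_bilinear[OF that]] by simp
  have skew: "G p (A p u v) w = - G p v (A p u w)" for u v w
  proof -
    have "D u (\<lambda>q. G q (J q v) w) p = D u (\<lambda>q. - G q v (J q w)) p"
      by (rule D_cong_on[OF p G_smooth_fields[OF J_smooth smooth_on_const] G_J])
    also have "\<dots> = - D u (\<lambda>q. G q v (J q w)) p"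
      by (rule frechet_derivative_minus_smooth[OF p G_smooth_fields[OF smooth_on_const J_smooth]])
    finally show ?thesis
      unfolding D_G[OF p J_smooth smooth_on_const] D_G[OF p smooth_on_const J_smooth] D_J
      by (simp add: G_simps G_J[OF p])
  qed
  have A_J: "A p u (J p v) = - J p (A p u v)" for u v
  proof -
    have "D u (\<lambda>q. J q (J q v)) p = D u (\<lambda>q. - v) p"
      by (rule D_cong_on[OF p smooth_on_operator_field[OF S J_field J_smooth] JJ])
    then show ?thesis
      unfolding D_operator_field[OF p J_field J_smooth] D_J
      by (simp add: J_simps JJ[OF p] Gam_simps add_eq_0_iff)
  qed
  show ?thesis
  proof (rule nk_point.intro)
    show "u = 0" if "\<And>v. G p u v = 0" for u by (rule G_nondegenerate[OF p that])
    show "A p u u = 0" for u unfolding A_def by (rule nearly_kaehler[OF p])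
  qed (fact G_bilinear[OF p] G_sym[OF p] J_linear[OF p] JJ[OF p] G_J_J[OF p] A_bilinear[OF p] skew A_J)+
qed

text \<open>The properties of \<open>B\<close> are the derivatives of those of \<open>A\<close>. The Ricci identity, the skewness
  of \<open>R\<close> and the Bianchi identity hold because the second derivatives of \<open>J\<close> and of \<open>g\<close> commute
  and because \<open>Gam\<close> is symmetric.\<close>

lemma nk_jet:
  assumes p: "p \<in> S"
  shows "nk_jet (G p) (J p) (A p) (B p) (R p)"
proof -
  interpret nk_point "G p" "J p" "A p" by (rule nk_point[OF p])
  note Gam = Gam_simps bilinear_rzero[OF Gam_bilinear]
  have B_swap: "B p w x y = - B p w y x" for w x y
  proof -
    have "D w (\<lambda>q. A q x y) p = D w (\<lambda>q. - A q y x) p"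
      by (rule D_cong_on[OF p A_smooth]) (rule nk_point.A_swap[OF nk_point])
    also have "\<dots> = - D w (\<lambda>q. A q y x) p"
      by (rule frechet_derivative_minus_smooth[OF p A_smooth])
    finally show ?thesis
      unfolding B_def using A_swap[of x y] A_swap[of "Gam p w x" y] A_swap[of x "Gam p w y"] by (simp add: Gam)
  qed
  have B_skew: "G p (B p w x y) z = - G p y (B p w x z)" for w x y z
  proof -
    have "D w (\<lambda>q. G q (A q x y) z) p = D w (\<lambda>q. - G q y (A q x z)) p"
      by (rule D_cong_on[OF p G_smooth_fields[OF A_smooth smooth_on_const]]) (rule nk_point.A_skew[OF nk_point])
    also have "\<dots> = - D w (\<lambda>q. G q y (A q x z)) p"
      by (rule frechet_derivative_minus_smooth[OF p G_smooth_fields[OF smooth_on_const A_smooth]])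
    finally show ?thesis
      unfolding D_G[OF p A_smooth smooth_on_const] D_G[OF p smooth_on_const A_smooth] B_def
      by (simp add: A_skew)
  qed
  have B_J: "B p w x (J p y) + J p (B p w x y) = - (A p x (A p w y) + A p w (A p x y))" for w x y
  proof -
    have "D w (\<lambda>q. A q x (J q y)) p = D w (\<lambda>q. - J q (A q x y)) p"
      by (rule D_cong_on[OF p smooth_on_operator_field[OF S A_field(1) J_smooth]]) (rule nk_point.A_J[OF nk_point])
    also have "\<dots> = - D w (\<lambda>q. J q (A q x y)) p"
      by (rule frechet_derivative_minus_smooth[OF p smooth_on_operator_field[OF S J_field A_smooth]])
    finally have "D w (\<lambda>q. A q x (J p y)) p + A p x (D w (\<lambda>q. J q y) p) =
        - (D w (\<lambda>q. J q (A p x y)) p + J p (D w (\<lambda>q. A q x y) p))"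
      unfolding D_operator_field[OF p A_field(1) J_smooth] D_operator_field[OF p J_field A_smooth] .
    then have "D w (\<lambda>q. A q x (J p y)) p = - A p x (A p w y - Gam p w (J p y) + J p (Gam p w y))
        - (A p w (A p x y) - Gam p w (J p (A p x y)) + J p (Gam p w (A p x y))) - J p (D w (\<lambda>q. A q x y) p)"
      unfolding D_J by (simp add: algebra_simps)
    then show ?thesis
      unfolding B_def by (simp add: A_J Gam algebra_simps)
  qed
  have ricci: "B p w x y - B p x w y = R p w x (J p y) - J p (R p w x y)" for w x y
  proof -
    have second: "D w (D x (\<lambda>q. J q y)) p = D w (\<lambda>q. A q x y) p
        - (D w (\<lambda>q. Gam q x (J p y)) p + Gam p x (D w (\<lambda>q. J q y) p))
        + (D w (\<lambda>q. J q (Gam p x y)) p + J p (D w (\<lambda>q. Gam q x y) p))" for w x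
    proof -
      have "D w (D x (\<lambda>q. J q y)) p = D w (\<lambda>q. A q x y - Gam q x (J q y) + J q (Gam q x y)) p"
        by (rule D_cong_on[OF p smooth_on_frechet_derivative[OF J_smooth] D_J])
      then show ?thesis
        by (simp add: frechet_derivative_add_smooth[OF p] frechet_derivative_diff_smooth[OF p] A_smooth
            smooth_on_diff[OF S] smooth_on_operator_field[OF S Gam_field J_smooth]
            smooth_on_operator_field[OF S J_field Gam_smooth]
            D_operator_field[OF p Gam_field J_smooth] D_operator_field[OF p J_field Gam_smooth])
    qed
    have "D w (D x (\<lambda>q. J q y)) p = D x (D w (\<lambda>q. J q y)) p"
      by (rule frechet_derivative_commute[OF S p J_smooth])
    then show ?thesis
      unfolding second unfolding D_J B_def R_def by (simp add: Gam Gam_sym[OF p, of x w] algebra_simps)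
  qed
  have Gam_linear: "linear (Gam p u)" for u
    using Gam_bilinear by (simp add: bilinear_def)
  have R_linear: "linear (R p w x)" for w x
    unfolding R_def[abs_def]
    by (intro linear_compose_add linear_compose_sub linear_frechet_derivative_operator_field[OF S p Gam_field]
        linear_compose[OF Gam_linear Gam_linear, unfolded o_def])
  have R_swap: "R p w x y = - R p x w y" for w x y
    by (simp add: R_def)
  have R_skew: "G p (R p w x y) z = - G p y (R p w x z)" for w x y z
  proof -
    have second: "D w (D x (\<lambda>q. G q y z)) p =
        G p (D w (\<lambda>q. Gam q x y) p + Gam p w (Gam p x y)) z + G p (Gam p x y) (Gam p w z)
        + (G p (Gam p w y) (Gam p x z) + G p y (D w (\<lambda>q. Gam q x z) p + Gam p w (Gam p x z)))" for w x
    proof -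
      have "D w (D x (\<lambda>q. G q y z)) p = D w (\<lambda>q. G q (Gam q x y) z + G q y (Gam q x z)) p"
        by (rule D_cong_on[OF p smooth_on_frechet_derivative[OF G_smooth]])
           (use D_G[OF _ smooth_on_const smooth_on_const] in simp)
      then show ?thesis
        by (simp add: frechet_derivative_add_smooth[OF p] G_smooth_fields Gam_smooth smooth_on_const
            D_G[OF p Gam_smooth smooth_on_const] D_G[OF p smooth_on_const Gam_smooth] del: g_simps)
    qed
    have "D w (D x (\<lambda>q. G q y z)) p = D x (D w (\<lambda>q. G q y z)) p"
      by (rule frechet_derivative_commute_real[OF S p G_smooth])
    then show ?thesis
      unfolding second R_def by (simp add: algebra_simps)
  qed
  have bianchi: "R p w x y + R p x y w + R p y w x = 0" for w x y
  proof -
    have "D u (\<lambda>q. Gam q v z) p = D u (\<lambda>q. Gam q z v) p" for u v z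
      by (rule D_cong_on[OF p Gam_smooth Gam_sym])
    from this[of w y x] this[of y x w] this[of x w y] show ?thesis
      unfolding R_def using Gam_sym[OF p, of y x] Gam_sym[OF p, of w x] Gam_sym[OF p, of y w] by simp
  qed
  show ?thesis
    by (intro nk_jet.intro nk_jet_axioms.intro nk_point[OF p]) (fact B_swap B_skew B_J ricci R_linear R_swap R_skew bianchi)+
qed

text \<open>\<open>B_eq\<close> says that \<open>A\<close> is parallel for the canonical connection, which differentiates a
  coordinate-constant field \<open>y\<close> along \<open>w\<close> to \<open>- P q w y\<close>.\<close>

definition P :: "real ^ 'n \<Rightarrow> real ^ 'n \<Rightarrow> real ^ 'n \<Rightarrow> real ^ 'n" where
  "P q w y = (1/2) *\<^sub>R J q (A q w y) - Gam q w y"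

lemma P_smooth: "smooth_on S (\<lambda>q. P q w y)"
  unfolding P_def
  by (intro smooth_on_diff[OF S] smooth_on_scaleR[OF S] smooth_on_const Gam_smooth
      smooth_on_operator_field[OF S J_field A_smooth])

lemma P_linear:
  assumes "q \<in> S"
  shows "linear (P q w)"
proof -
  interpret nk_point "G q" "J q" "A q" by (rule nk_point[OF assms])
  show ?thesis
    by (rule linearI) (simp_all add: P_def Gam_simps scaleR_right_distrib scaleR_right_diff_distrib)
qed

lemma P_field: "operator_field S (\<lambda>q. P q w)"
  using P_linear P_smooth by (simp add: operator_field_def)

lemma D_A:
  assumes q: "q \<in> S"
  shows "D w (\<lambda>q. A q x y) q = P q w (A q x y) - A q (P q w x) y - A q x (P q w y)"
proof -
  interpret nk_jet "G q" "J q" "A q" "B q" "R q" by (rule nk_jet[OF q])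
  have "D w (\<lambda>q. A q x y) q = B q w x y - Gam q w (A q x y) + A q (Gam q w x) y + A q x (Gam q w y)"
    by (simp add: B_def)
  then show ?thesis
    unfolding B_eq P_def A_swap[of y "A q w x"]
    by (simp add: A_J A_J_left scaleR_right_distrib scaleR_right_diff_distrib)
qed

text \<open>In terms of the connection form \<open>- P\<close> this is the usual formula for the curvature.\<close>

definition N :: "real ^ 'n \<Rightarrow> real ^ 'n \<Rightarrow> real ^ 'n \<Rightarrow> real ^ 'n \<Rightarrow> real ^ 'n" where
  "N p u w y = D w (\<lambda>q. P q u y) p - D u (\<lambda>q. P q w y) p + P p u (P p w y) - P p w (P p u y)"

text \<open>A curvature annihilates every parallel tensor: differentiate \<open>D_A\<close> once more and exchange the
  two derivatives.\<close>

lemma N_annihilates: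
  assumes p: "p \<in> S"
  shows "N p u w (A p x y) = A p (N p u w x) y + A p x (N p u w y)"
proof -
  interpret nk_point "G p" "J p" "A p" by (rule nk_point[OF p])
  have second: "D u (D w (\<lambda>q. A q x y)) p =
      D u (\<lambda>q. P q w (A p x y)) p + P p w (D u (\<lambda>q. A q x y) p)
      - (D u (\<lambda>q. A q (P p w x) y) p + A p (D u (\<lambda>q. P q w x) p) y)
      - (D u (\<lambda>q. A q x (P p w y)) p + A p x (D u (\<lambda>q. P q w y) p))" for u w
  proof -
    have "D u (D w (\<lambda>q. A q x y)) p = D u (\<lambda>q. P q w (A q x y) - A q (P q w x) y - A q x (P q w y)) p"
      by (rule D_cong_on[OF p smooth_on_frechet_derivative[OF A_smooth] D_A])
    then show ?thesis
      by (simp add: frechet_derivative_diff_smooth[OF p] smooth_on_diff[OF S]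
          smooth_on_operator_field[OF S P_field A_smooth] smooth_on_operator_field[OF S A_field(1) P_smooth]
          smooth_on_operator_field[OF S A_field(2) P_smooth]
          D_operator_field[OF p P_field A_smooth] D_operator_field[OF p A_field(1) P_smooth]
          D_operator_field[OF p A_field(2) P_smooth])
  qed
  note P_simps = linear_add[OF P_linear[OF p]] linear_diff[OF P_linear[OF p]]
  have "D u (D w (\<lambda>q. A q x y)) p = D w (D u (\<lambda>q. A q x y)) p"
    by (rule frechet_derivative_commute[OF S p A_smooth])
  then show ?thesis
    unfolding second N_def by (simp add: D_A[OF p] P_simps algebra_simps)
qed

lemma N_eq:
  assumes p: "p \<in> S"
  shows "N p u w y = R p u w y - (1/4) *\<^sub>R (A p u (A p w y) - A p w (A p u y)) + (1/2) *\<^sub>R A p (A p u w) y"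
proof -
  interpret nk_jet "G p" "J p" "A p" "B p" "R p" by (rule nk_jet[OF p])
  have DP: "D u (\<lambda>q. P q w y) p = (1/2) *\<^sub>R (A p u (A p w y) - Gam p u (J p (A p w y)) + J p (Gam p u (A p w y))
      + J p (B p u w y - Gam p u (A p w y) + A p (Gam p u w) y + A p w (Gam p u y))) - D u (\<lambda>q. Gam q w y) p" for u w
  proof -
    have "D u (\<lambda>q. P q w y) p = (1/2) *\<^sub>R D u (\<lambda>q. J q (A q w y)) p - D u (\<lambda>q. Gam q w y) p"
      unfolding P_def
      by (simp add: frechet_derivative_diff_smooth[OF p] frechet_derivative_scaleR_smooth[OF p] Gam_smooth
          smooth_on_scaleR[OF S] smooth_on_const smooth_on_operator_field[OF S J_field A_smooth])
    also have "D u (\<lambda>q. J q (A q w y)) p = D u (\<lambda>q. J q (A p w y)) p + J p (D u (\<lambda>q. A q w y) p)"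
      by (rule D_operator_field[OF p J_field A_smooth])
    also have "D u (\<lambda>q. A q w y) p = B p u w y - Gam p u (A p w y) + A p (Gam p u w) y + A p w (Gam p u y)"
      by (simp add: B_def)
    finally show ?thesis unfolding D_J .
  qed
  show ?thesis
    unfolding N_def DP unfolding R_def P_def B_eq A_swap[of w u] A_swap[of "A p u w" y]
    by (simp add: Gam_simps Gam_sym[OF p, of w u] A_J A_J_left scaleR_right_distrib scaleR_right_diff_distrib)
qed

lemma ricci_eq: "ricci G p v w = tr (\<lambda>u. R p u v w)"
proof -
  have cc: "cov_deriv G (\<lambda>_. v) (\<lambda>_. w) = (\<lambda>q. Gam q v w)" for v w
    by (simp add: fun_eq_iff cov_deriv_eq)
  have lb: "lie_bracket (\<lambda>_. u) (\<lambda>_. v) = (\<lambda>_. 0)" for u v :: "real ^ 'n"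
    by (simp add: fun_eq_iff lie_bracket_def)
  have "riemann G (\<lambda>_. u) (\<lambda>_. v) (\<lambda>_. w) p = R p u v w" for u
    unfolding riemann_def lb cc cov_deriv_eq R_def by (simp add: bilinear_lzero[OF Gam_bilinear])
  then show ?thesis by (simp add: ricci_def)
qed

theorem ricci_constant_type:
  assumes p: "p \<in> S" and card: "CARD('n) = 6" and strict: "\<And>u. u \<noteq> 0 \<Longrightarrow> \<exists>v. A p u v \<noteq> 0"
    and type: "\<And>u v. G p (A p u v) (A p u v) = \<alpha> * (G p u u * G p v v - (G p u v)\<^sup>2 - (G p (J p u) v)\<^sup>2)"
  shows "ricci G p v w = 5 * \<alpha> * G p v w"
proof -
  interpret nk_jet "G p" "J p" "A p" "B p" "R p" by (rule nk_jet[OF p])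
  interpret nk_curvature "G p" "J p" "A p" "B p" "R p" \<alpha> "N p"
    by unfold_locales (fact type N_eq[OF p] N_annihilates[OF p] card strict)+
  show ?thesis unfolding ricci_eq by (rule einstein_at_point)
qed

end

section \<open>Passing from the manifold to a chart\<close>

text \<open>A chart around \<open>p\<close> identifies the tangent space with coordinate vectors through \<open>tangent_of\<close>,
  which turns the tensors on the manifold into their coordinate expressions.\<close>

locale atlas =
  fixes M :: "'a topology" and A :: "('a, 'n::finite) chart set"
  assumes smooth: "smooth_manifold M A"
begin

lemma chart_openin: "c \<in> A \<Longrightarrow> openin M (fst c)"
  and chart_range_open: "c \<in> A \<Longrightarrow> open (snd c ` fst c)"
  and chart_homeomorphic: "c \<in> A \<Longrightarrow> homeomorphic_map (subtopology M (fst c)) (top_of_set (snd c ` fst c)) (snd c)"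
  using smooth by (auto simp: smooth_manifold_def chart_on_def)

lemma chart_topspace: "c \<in> A \<Longrightarrow> p \<in> fst c \<Longrightarrow> p \<in> topspace M"
  using chart_openin openin_subset by blast

lemma chart_inv: "c \<in> A \<Longrightarrow> p \<in> fst c \<Longrightarrow> chart_inv c (snd c p) = p"
  unfolding chart_inv_def
  using homeomorphic_imp_injective_map[OF chart_homeomorphic, of c] openin_subset[OF chart_openin, of c]
  by (intro inv_into_f_f) (auto simp: Int_absorb1)

lemma open_chart_image:
  assumes "c \<in> A" "openin M W" "W \<subseteq> fst c"
  shows "open (snd c ` W)"
proof -
  have "openin (subtopology M (fst c)) W"
    using assms by (auto simp: openin_subtopology)
  then have "openin (top_of_set (snd c ` fst c)) (snd c ` W)"
    using homeomorphic_imp_open_map[OF chart_homeomorphic[OF assms(1)]] by (auto simp: open_map_def)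
  then show ?thesis
    using chart_range_open[OF assms(1)] openin_open_trans by blast
qed

lemma transition_differentiable:
  assumes "c \<in> A" "c' \<in> A" "p \<in> fst c \<inter> fst c'"
  shows "transition c c' differentiable (at (snd c p))"
  using smooth assms
  by (intro smooth_on_differentiable[of "snd c ` (fst c \<inter> fst c')"]) (auto simp: smooth_manifold_def)

lemma frechet_derivative_transition_self:
  assumes "c \<in> A" "p \<in> fst c"
  shows "frechet_derivative (transition c c) (at (snd c p)) u = u"
proof -
  have "((\<lambda>x. x) has_derivative (\<lambda>x. x)) (at (snd c p))" by simp
  then have "(transition c c has_derivative (\<lambda>x. x)) (at (snd c p))"
    by (rule has_derivative_transform_within_open[OF _ chart_range_open[OF assms(1)]])
       (use assms in \<open>auto simp: transition_def chart_inv\<close>)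
  from frechet_derivative_at[OF this] show ?thesis by metis
qed

text \<open>This cocycle property makes \<open>tangent_of\<close> a tangent vector.\<close>

lemma frechet_derivative_transition_comp:
  assumes c: "c \<in> A" "c' \<in> A" "c'' \<in> A" and p: "p \<in> fst c" "p \<in> fst c'" "p \<in> fst c''"
  shows "frechet_derivative (transition c c'') (at (snd c p)) u =
    frechet_derivative (transition c' c'') (at (snd c' p)) (frechet_derivative (transition c c') (at (snd c p)) u)"
proof -
  let ?W = "fst c \<inter> fst c' \<inter> fst c''"
  have W: "open (snd c ` ?W)"
    by (rule open_chart_image[OF c(1)]) (use c in \<open>auto intro!: chart_openin\<close>)
  have "(transition c c' has_derivative frechet_derivative (transition c c') (at (snd c p))) (at (snd c p))"
    using transition_differentiable[of c c' p] c p by (simp add: frechet_derivative_works)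
  moreover have "(transition c' c'' has_derivative frechet_derivative (transition c' c'') (at (snd c' p)))
      (at (transition c c' (snd c p)))"
    using transition_differentiable[of c' c'' p] c p by (simp add: frechet_derivative_works transition_def chart_inv)
  ultimately have "(transition c' c'' \<circ> transition c c' has_derivative
      frechet_derivative (transition c' c'') (at (snd c' p)) \<circ> frechet_derivative (transition c c') (at (snd c p)))
      (at (snd c p))"
    by (rule diff_chain_at)
  then have "(transition c c'' has_derivative
      frechet_derivative (transition c' c'') (at (snd c' p)) \<circ> frechet_derivative (transition c c') (at (snd c p)))
      (at (snd c p))"
    by (rule has_derivative_transform_within_open[OF _ W]) (use c p in \<open>auto simp: transition_def chart_inv\<close>)
  from frechet_derivative_at[OF this] show ?thesis by (metis comp_apply)
qed

context
  fixes c p assumes c: "c \<in> A" and p: "p \<in> fst c"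
begin

lemma tangent_of_mem: "tangent_of A c p u \<in> tangent_space A p"
  unfolding tangent_space_def
proof (intro CollectI conjI allI impI ballI)
  show "tangent_of A c p u c' = 0" if "\<not> (c' \<in> A \<and> p \<in> fst c')" for c'
    using that unfolding tangent_of_def by (rule if_not_P)
  fix c' c''
  assume "c' \<in> A" "c'' \<in> A" and "p \<in> fst c' \<inter> fst c''"
  then show "tangent_of A c p u c'' = frechet_derivative (transition c' c'') (at (snd c' p)) (tangent_of A c p u c')"
    using frechet_derivative_transition_comp[OF c _ _ p, of c' c'' u] by (simp add: tangent_of_def)
qed

lemma tangent_of_coordinate: "tangent_of A c p u c = u"
  using frechet_derivative_transition_self[OF c p] c p by (simp add: tangent_of_def)

lemma tangent_of_eq: "v \<in> tangent_space A p \<Longrightarrow> tangent_of A c p (v c) = v"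
proof
  fix c' assume v: "v \<in> tangent_space A p"
  show "tangent_of A c p (v c) c' = v c'"
  proof (cases "c' \<in> A \<and> p \<in> fst c'")
    case True
    then have "v c' = frechet_derivative (transition c c') (at (snd c p)) (v c)"
      using v c p unfolding tangent_space_def by blast
    with True show ?thesis by (simp add: tangent_of_def)
  next
    case False
    with v have "v c' = 0" unfolding tangent_space_def by blast
    with False show ?thesis by (auto simp: tangent_of_def)
  qed
qed

lemma tangent_of_lincomb:
  "tangent_of A c p (a *\<^sub>R u + b *\<^sub>R v) = tlincomb a (tangent_of A c p u) b (tangent_of A c p v)"
proof
  fix c'
  show "tangent_of A c p (a *\<^sub>R u + b *\<^sub>R v) c' = tlincomb a (tangent_of A c p u) b (tangent_of A c p v) c'"
  proof (cases "c' \<in> A \<and> p \<in> fst c'")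
    case True
    then have "linear (frechet_derivative (transition c c') (at (snd c p)))"
      using c p by (intro linear_frechet_derivative transition_differentiable) auto
    then show ?thesis
      by (simp add: tangent_of_def tlincomb_def linear_add linear_cmul)
  qed (auto simp: tangent_of_def tlincomb_def)
qed

lemma tangent_of_zero: "tangent_of A c p 0 = (\<lambda>_. 0)"
  using tangent_of_lincomb[of 0 0 0 0] by (simp add: tlincomb_def)

lemma tangent_of_eq_zero_iff: "tangent_of A c p u = (\<lambda>_. 0) \<longleftrightarrow> u = 0"
  using tangent_of_coordinate[of u] tangent_of_zero by metis

lemma local_metric_eq: "local_metric A g c (snd c p) u v = g p (tangent_of A c p u) (tangent_of A c p v)"
  by (simp add: local_metric_def chart_inv[OF c p])

lemma tangent_of_local_endo:
  assumes "almost_complex_structure M A J"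
  shows "tangent_of A c p (local_endo A J c (snd c p) u) = J p (tangent_of A c p u)"
  using assms tangent_of_eq[of "J p (tangent_of A c p u)"] tangent_of_mem chart_topspace[OF c p]
  by (simp add: local_endo_def chart_inv[OF c p] almost_complex_structure_def)

end

lemma local_nearly_kaehler:
  assumes nk: "nearly_pseudo_kaehler M A g J" and c: "c \<in> A"
  shows "local_nearly_kaehler (snd c ` fst c) (local_metric A g c) (local_endo A J c)"
proof -
  let ?G = "local_metric A g c" and ?J = "local_endo A J c"
  have metric: "pseudo_riemannian_metric M A g" and acs: "almost_complex_structure M A J"
    and compat: "\<And>p u v. p \<in> topspace M \<Longrightarrow> u \<in> tangent_space A p \<Longrightarrow> v \<in> tangent_space A p \<Longrightarrow> g p (J p u) (J p v) = g p u v"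
    and nabla: "\<And>p v. p \<in> fst c \<Longrightarrow> v \<in> tangent_space A p \<Longrightarrow> nabla_J A g J c p v v = (\<lambda>_. 0)"
    using nk c chart_topspace[OF c] by (auto simp: nearly_pseudo_kaehler_def almost_pseudo_hermitian_def)
  have g_lincomb: "g p (tlincomb a u b v) w = a * g p u w + b * g p v w"
    if "p \<in> fst c" "u \<in> tangent_space A p" "v \<in> tangent_space A p" "w \<in> tangent_space A p" for p u v w a b
    using metric that chart_topspace[OF c] unfolding pseudo_riemannian_metric_def by blast
  have g_sym: "g p u w = g p w u"
    if "p \<in> fst c" "u \<in> tangent_space A p" "w \<in> tangent_space A p" for p u w
    using metric that chart_topspace[OF c] unfolding pseudo_riemannian_metric_def by blast
  have g_nondeg: "u = (\<lambda>_. 0)"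
    if "p \<in> fst c" "u \<in> tangent_space A p" "\<And>v. v \<in> tangent_space A p \<Longrightarrow> g p u v = 0" for p u
    using metric that chart_topspace[OF c] unfolding pseudo_riemannian_metric_def by blast
  have JJ: "J p (J p u) = (\<lambda>c. - u c)" if "p \<in> fst c" "u \<in> tangent_space A p" for p u
    using acs that chart_topspace[OF c] unfolding almost_complex_structure_def by blast
  have J_lincomb: "J p (tlincomb a u b v) = tlincomb a (J p u) b (J p v)"
    if "p \<in> fst c" "u \<in> tangent_space A p" "v \<in> tangent_space A p" for p u v a b
    using acs that chart_topspace[OF c] unfolding almost_complex_structure_def by blast
  note mem = tangent_of_mem[OF c] and endo = tangent_of_local_endo[OF c _ acs] and G = local_metric_eq[OF c]
  show ?thesis
  proof (rule local_nearly_kaehler.intro)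
    show "open (snd c ` fst c)" by (rule chart_range_open[OF c])
    show "smooth_on (snd c ` fst c) (\<lambda>x. ?G x u v)" for u v
      using metric c by (simp add: pseudo_riemannian_metric_def)
    show "?G x u v = ?G x v u" if "x \<in> snd c ` fst c" for x u v
      using that by (auto simp: G intro!: g_sym mem)
    show "bilinear (?G x)" if x: "x \<in> snd c ` fst c" for x
    proof -
      obtain p where p: "p \<in> fst c" and x: "x = snd c p" using x by blast
      have left: "?G x (a *\<^sub>R u + b *\<^sub>R v) w = a * ?G x u w + b * ?G x v w" for a b u v w
        unfolding x G[OF p] tangent_of_lincomb[OF c p] by (intro g_lincomb p mem)
      have sym: "?G x u v = ?G x v u" for u v
        unfolding x G[OF p] by (intro g_sym p mem)
      have right: "?G x w (a *\<^sub>R u + b *\<^sub>R v) = a * ?G x w u + b * ?G x w v" for a b u v w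
        using left[of a u b v w] sym by metis
      show ?thesis
        unfolding bilinear_def
        using left[of 1 _ 1] left[of _ _ 0 0] right[of _ 1 _ 1] right[of _ _ _ 0 0] by (auto intro!: linearI)
    qed
    show "u = 0" if x: "x \<in> snd c ` fst c" and z: "\<And>v. ?G x u v = 0" for x u
    proof -
      obtain p where p: "p \<in> fst c" and x: "x = snd c p" using x by blast
      have "g p (tangent_of A c p u) v = 0" if "v \<in> tangent_space A p" for v
        using z[of "v c"] unfolding x G[OF p] tangent_of_eq[OF c p that] .
      then have "tangent_of A c p u = (\<lambda>_. 0)"
        using g_nondeg p mem by metis
      then show ?thesis using tangent_of_eq_zero_iff[OF c p] by blast
    qed
    show "?J x (?J x u) = - u" if x: "x \<in> snd c ` fst c" for x u
    proof -
      obtain p where p: "p \<in> fst c" and x: "x = snd c p" using x by blast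
      have "tangent_of A c p (?J x (?J x u)) = (\<lambda>c'. - tangent_of A c p u c')"
        unfolding x endo[OF p] by (rule JJ[OF p mem[OF p]])
      from fun_cong[OF this, of c] show ?thesis
        by (simp add: tangent_of_coordinate[OF c p])
    qed
    show "?G x (?J x u) (?J x v) = ?G x u v" if "x \<in> snd c ` fst c" for x u v
      using that by (auto simp: G endo intro!: compat mem chart_topspace[OF c])
    show "operator_field (snd c ` fst c) ?J"
      unfolding operator_field_def
    proof (intro conjI ballI allI)
      show "smooth_on (snd c ` fst c) (\<lambda>x. ?J x u)" for u
        using acs c by (simp add: almost_complex_structure_def)
      fix x assume "x \<in> snd c ` fst c"
      then obtain p where p: "p \<in> fst c" and x: "x = snd c p" by blast
      have J: "?J x (a *\<^sub>R u + b *\<^sub>R v) = a *\<^sub>R ?J x u + b *\<^sub>R ?J x v" for a b u v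
      proof -
        have "tangent_of A c p (?J x (a *\<^sub>R u + b *\<^sub>R v)) = tangent_of A c p (a *\<^sub>R ?J x u + b *\<^sub>R ?J x v)"
          unfolding tangent_of_lincomb[OF c p] x endo[OF p] by (rule J_lincomb[OF p mem[OF p] mem[OF p]])
        from fun_cong[OF this, of c] show ?thesis
          by (simp add: tangent_of_coordinate[OF c p])
      qed
      show "linear (?J x)"
        using J[of 1 _ 1] J[of _ _ 0 0] by (auto intro!: linearI)
    qed
    show "cov_deriv_endo ?G ?J (\<lambda>_. u) (\<lambda>_. u) x = 0" if x: "x \<in> snd c ` fst c" for x u
    proof -
      obtain p where p: "p \<in> fst c" and x: "x = snd c p" using x by blast
      show ?thesis
        using nabla[OF p mem[OF p, of u]] unfolding x
        by (simp add: nabla_J_def tangent_of_coordinate[OF c p] tangent_of_eq_zero_iff[OF c p])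
    qed
  qed
qed

lemma einstein:
  assumes strict: "strict_nearly_pseudo_kaehler M A g J" and type: "constant_type M A g J \<alpha>"
    and card: "CARD('n) = 6"
  shows "pseudo_riemannian_einstein M A g (5 * \<alpha>)"
  unfolding pseudo_riemannian_einstein_def
proof (intro conjI ballI impI)
  have nk: "nearly_pseudo_kaehler M A g J"
    using strict by (simp add: strict_nearly_pseudo_kaehler_def)
  then show "pseudo_riemannian_metric M A g"
    by (simp add: nearly_pseudo_kaehler_def almost_pseudo_hermitian_def)
  have acs: "almost_complex_structure M A J"
    using nk by (simp add: nearly_pseudo_kaehler_def almost_pseudo_hermitian_def)
  fix p c v w
  assume p': "p \<in> topspace M" and c: "c \<in> A" and p: "p \<in> fst c"
    and v: "v \<in> tangent_space A p" and w: "w \<in> tangent_space A p"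
  let ?G = "local_metric A g c" and ?J = "local_endo A J c" and ?x = "snd c p" and ?t = "tangent_of A c p"
  interpret loc: local_nearly_kaehler "snd c ` fst c" ?G ?J
    by (rule local_nearly_kaehler[OF nk c])
  have nabla: "nabla_J A g J c p (?t u) (?t z) = ?t (loc.A ?x u z)" for u z
    by (simp add: nabla_J_def tangent_of_coordinate[OF c p] loc.A_def)
  have "ricci ?G ?x (v c) (w c) = 5 * \<alpha> * ?G ?x (v c) (w c)"
  proof (rule loc.ricci_constant_type[OF _ card])
    show "?x \<in> snd c ` fst c" using p by blast
    show "\<exists>z. loc.A ?x u z \<noteq> 0" if "u \<noteq> 0" for u
    proof -
      have "?t u \<noteq> (\<lambda>_. 0)" using that by (simp add: tangent_of_eq_zero_iff[OF c p])
      then obtain z where z: "z \<in> tangent_space A p" "nabla_J A g J c p (?t u) z \<noteq> (\<lambda>_. 0)"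
        using strict p' c p tangent_of_mem[OF c p] unfolding strict_nearly_pseudo_kaehler_def by blast
      then have "?t (loc.A ?x u (z c)) \<noteq> (\<lambda>_. 0)"
        using nabla[of u "z c"] tangent_of_eq[OF c p z(1)] by simp
      then show ?thesis using tangent_of_eq_zero_iff[OF c p] by blast
    qed
    show "?G ?x (loc.A ?x u z) (loc.A ?x u z) =
        \<alpha> * (?G ?x u u * ?G ?x z z - (?G ?x u z)\<^sup>2 - (?G ?x (?J ?x u) z)\<^sup>2)" for u z
      using type p' c p tangent_of_mem[OF c p]
      unfolding constant_type_def local_metric_eq[OF c p] tangent_of_local_endo[OF c p acs] nabla[symmetric] by blast
  qed
  then show "ricci ?G ?x (v c) (w c) = 5 * \<alpha> * g p v w"
    by (simp add: local_metric_eq[OF c p] tangent_of_eq[OF c p] v w)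
qed

end

theorem theorem2p11:
  fixes M :: "'a topology" and A :: "('a, 6) chart set"
    and g :: "('a, 6) tmetric" and J :: "('a, 6) tendo" and \<alpha> :: real
  assumes "smooth_manifold M A"
    and "strict_nearly_pseudo_kaehler M A g J"
    and "constant_type M A g J \<alpha>"
  shows "pseudo_riemannian_einstein M A g (5 * \<alpha>)"
  using atlas.einstein[OF atlas.intro[OF assms(1)] assms(2,3)] by simp

end
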